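(* Let $n\ge 1$ and $m\ge n+1$ be integers. Let $M^n_m=\sup_{K\in\mathbb{P}^n_m}\mathcal{P}(K)$. Then the supremum $M^n_m$ is achieved at some polytope with exactly $m$ vertices, and the sequence $M^n_m$ is strictly increasing in $m$.
   Context: A convex body in $\mathbb{R}^n$ is a compact convex subset with nonempty interior; $|\cdot|$ denotes volume (Lebesgue measure). For a convex body $K\subset\mathbb{R}^n$ and $z\in\mathrm{int}(K)$, the polar body of $K$ with center of polarity $z$ is $K^z=\{y\in\mathbb{R}^n:\langle y-z,x-z\rangle\le 1\ \text{for all } x\in K\}$. The volume product of $K$ is $\mathcal{P}(K)=\inf\{|K|\,|K^z|: z\in\mathrm{int}(K)\}$. For $n\ge 1$ and $m\ge n+1$, $\mathbb{P}^n_m$ denotes the set of polytopes in $\mathbb{R}^n$ with nonempty interior having at most $m$ vertices.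
   Formalization: For n=1 all polytopes are segments with 2 vertices and M^1_m=4 for all m, so the claim fails there; the formal version asserts exactly m vertices only for n≥2 or m=n+1, and strict increase only for n≥2, while attainment is kept for all n≥1. *)

theory Defs
  imports "HOL-Analysis.Analysis"
begin

definition polar_body :: "'a::euclidean_space set \<Rightarrow> 'a \<Rightarrow> 'a set" where
  "polar_body K z = {y. \<forall>x\<in>K. (y - z) \<bullet> (x - z) \<le> 1}"

text \<open>
  The infimum is taken in the reals. It is genuine for a convex body \<open>K\<close>: then \<open>interior K\<close> is
  nonempty, every \<open>polar_body K z\<close> with \<open>z \<in> interior K\<close> is compact (so its measure is its true,
  finite volume), and the values are bounded below by 0.
\<close>
definition volume_product :: "'a::euclidean_space set \<Rightarrow> real" where
  "volume_product K =
     (INF z\<in>interior K. measure lebesgue K * measure lebesgue (polar_body K z))"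

abbreviation vertices :: "'a::euclidean_space set \<Rightarrow> 'a set" where
  "vertices K \<equiv> {v. v extreme_point_of K}"

text \<open>A polytope has finitely many extreme points, so \<open>card\<close> is the true number of vertices.\<close>
definition polytopes_at_most :: "nat \<Rightarrow> 'a::euclidean_space set set" where
  "polytopes_at_most m = {K. polytope K \<and> interior K \<noteq> {} \<and> card (vertices K) \<le> m}"

text \<open>
  The supremum is taken in the extended reals, so that no boundedness is presupposed; its being
  attained in particular says that it is finite. The type argument carries the ambient space.
\<close>
definition max_volume_product :: "'a::euclidean_space itself \<Rightarrow> nat \<Rightarrow> ereal" where
  "max_volume_product _ m =
     (SUP K\<in>(polytopes_at_most m :: 'a set set). ereal (volume_product K))"

text \<open>
  In dimension 1 every polytope with nonempty interior is a segment and has exactly 2 vertices, so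
  for \<open>m \<ge> 3\<close> there is none with exactly \<open>m\<close> vertices, and \<open>max_volume_product\<close> is constant in \<open>m\<close>.
  This is why the exact vertex count (for \<open>m \<ge> 3\<close>) and the strict monotonicity are only claimed in
  dimension at least 2.
\<close>

end

theory Submission
  imports Defs
begin

text \<open>
  The theorem rests on two facts: for each \<open>m\<close> the supremum is attained, and adding one suitable
  vertex strictly increases the volume product in dimension at least two. Strict monotonicity in \<open>m\<close>
  is then immediate, and so is the exact vertex count: a maximizer for \<open>m\<close> with at most \<open>m - 1\<close>
  vertices would bound the maximum for \<open>m\<close> by the smaller maximum for \<open>m - 1\<close>, unless
  \<open>m = n + 1\<close>, where every polytope with interior has \<open>n + 1\<close> vertices anyway.

  \<^emph>\<open>Attainment\<close> (\<open>volume_product_maximizer_exists\<close>). The volume product is affinely invariant, since a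
  linear map scales a body and its polar by reciprocal factors. Choosing a simplex of largest volume
  among the vertices and mapping it to the standard simplex puts every competitor between that simplex
  and a fixed ball (\<open>normalized_representative\<close>), so a maximizing sequence of vertex tuples has a
  convergent subsequence. The limit is a maximizer because the volume product is upper semicontinuous:
  as an infimum over centers it needs only, for each single center \<open>z\<close>, an upper bound for
  the volumes of nearby bodies and of their polars at \<open>z\<close> (\<open>volume_product_le_of_near\<close>).

  \<^emph>\<open>Strict increase\<close> (\<open>apex_increases_volume_product\<close>). Over a relative interior point \<open>p\<close> of a facet
  of \<open>K\<close> with unit normal \<open>u\<close> put the new vertex \<open>p + t u\<close>. The volume of \<open>K\<close> grows at least linearly
  in \<open>t\<close> (\<open>apex_volume_gain\<close>). The polar \<open>K\<^sup>z\<close> is cut by a half-space which, as \<open>t\<close> tends to 0, only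
  touches the vertex of \<open>K\<^sup>z\<close> dual to the facet; the part cut off lies in a ball of radius \<open>O(t)\<close>
  and has volume \<open>O(t\<^sup>n)\<close> (\<open>apex_polar_loss\<close>). For \<open>n \<ge> 2\<close> the gain wins. The bounds are uniform as long
  as \<open>z\<close> keeps a fixed distance from the boundary of \<open>K\<close>; for the other centers the polar is so long in
  one direction that its volume is as large as desired (\<open>polar_volume_blowup\<close>).
\<close>

section \<open>Linear maps and Lebesgue measure\<close>

text \<open>
  A shear preserves the volume of boxes on which the added coordinate is nonnegative. Any box can be
  translated to such a one, and the translation passes through the shear.
\<close>
lemma measure_shear_image:
  fixes S :: "(real^'n) set" and m n :: 'n
  defines "h \<equiv> (\<lambda>x::real^'n. \<chi> i. if i = m then x$m + x$n else x$i)"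
  assumes "m \<noteq> n" and S: "S \<in> lmeasurable"
  shows "h ` S \<in> lmeasurable \<and> measure lebesgue (h ` S) = measure lebesgue S"
proof -
  have lin: "linear h"
    unfolding h_def by (rule linearI) (auto simp: vec_eq_iff algebra_simps)
  have "measure lebesgue (h ` cbox a b) = 1 * measure lebesgue (cbox a b)" for a b
  proof (cases "cbox a b = {}")
    case False
    define v :: "real^'n" where "v = axis n (- a $ n)"
    have "h ` (+) v ` cbox a b = (+) (h v) ` h ` cbox a b"
      by (simp add: image_image linear_add[OF lin])
    then have "measure lebesgue (h ` cbox a b) = measure lebesgue (h ` (+) v ` cbox a b)"
      by (simp add: measure_translation)
    also have "\<dots> = measure lebesgue (h ` cbox (v + a) (v + b))"
      by (simp add: cbox_translation)
    also have "\<dots> = measure lebesgue (cbox (v + a) (v + b))"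
      unfolding h_def using \<open>m \<noteq> n\<close> False
      by (intro measure_shear_interval) (simp_all add: v_def cbox_translation)
    also have "\<dots> = measure lebesgue (cbox a b)"
      by (simp only: cbox_translation measure_translation)
    finally show ?thesis by simp
  qed auto
  from measure_linear_sufficient[OF lin S this] show ?thesis by simp
qed

text \<open>
  The index type carries no order, so the determinant of a shear is computed by a row operation rather
  than as that of a triangular matrix. Shears and diagonal maps suffice: a coordinate swap is a product
  of three shears and three sign changes.
\<close>
lemma measure_linear_image_cart:
  fixes f :: "real^'n \<Rightarrow> real^'n"
  assumes "linear f" "S \<in> lmeasurable"
  shows "f ` S \<in> lmeasurable \<and> measure lebesgue (f ` S) = \<bar>det (matrix f)\<bar> * measure lebesgue S"
proof -
  define P where "P f \<longleftrightarrow> linear f \<and> (\<forall>S\<in>lmeasurable. f ` S \<in> lmeasurable \<and>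
      measure lebesgue (f ` S) = \<bar>det (matrix f)\<bar> * measure lebesgue S)" for f :: "real^'n \<Rightarrow> real^'n"
  have comp: "P (f \<circ> g)" if "P f" "P g" for f g
    unfolding P_def
  proof (intro conjI ballI)
    have lin: "linear f" "linear g" using that by (auto simp: P_def)
    then show "linear (f \<circ> g)" by (simp add: linear_compose)
    fix S :: "(real^'n) set" assume S: "S \<in> lmeasurable"
    then have g: "g ` S \<in> lmeasurable" "measure lebesgue (g ` S) = \<bar>det (matrix g)\<bar> * measure lebesgue S"
      using \<open>P g\<close> by (auto simp: P_def)
    with \<open>P f\<close> have "f ` g ` S \<in> lmeasurable"
        "measure lebesgue (f ` g ` S) = \<bar>det (matrix f)\<bar> * measure lebesgue (g ` S)"
      unfolding P_def by blast+
    then show "(f \<circ> g) ` S \<in> lmeasurable"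
      "measure lebesgue ((f \<circ> g) ` S) = \<bar>det (matrix (f \<circ> g))\<bar> * measure lebesgue S"
      using g lin by (simp_all only: image_comp matrix_compose det_mul abs_mult mult.assoc)
  qed
  have stretch: "P (\<lambda>x. \<chi> i. c i * x$i)" for c
  proof -
    have "matrix (\<lambda>x. \<chi> i. c i * x$i) $ i $ j = 0" if "i \<noteq> j" for i j
      using that by (simp add: matrix_def axis_def)
    then have "det (matrix (\<lambda>x. \<chi> i. c i * x$i)) = prod c UNIV"
      by (subst det_diagonal) (auto simp: matrix_def axis_def)
    moreover have "linear (\<lambda>x::real^'n. \<chi> i. c i * x$i)"
      by (rule linearI) (auto simp: vec_eq_iff algebra_simps)
    ultimately show ?thesis
      by (simp add: P_def measurable_stretch measure_stretch)
  qed
  have shear: "P (\<lambda>x. \<chi> i. if i = m then x$m + x$n else x$i)" if "m \<noteq> n" for m n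
  proof -
    let ?h = "\<lambda>x::real^'n. \<chi> i. if i = m then x$m + x$n else x$i"
    have lin: "linear ?h" 
      by (rule linearI) (auto simp: vec_eq_iff algebra_simps)
    have "matrix ?h = (\<chi> k. if k = m then row m (mat 1) + 1 *s row n (mat 1) else row k (mat 1))"
      by (auto simp: vec_eq_iff matrix_def row_def mat_def axis_def)
    then have "det (matrix ?h) = 1"
      using det_row_operation[OF that, of "mat 1" 1] by simp
    then show ?thesis
      using lin measure_shear_image[OF that] by (simp add: P_def)
  qed
  have swap: "P (\<lambda>x. \<chi> i. x $ Transposition.transpose m n i)" if "m \<noteq> n" for m n
  proof -
    define d where "d = (\<lambda>k (x::real^'n). \<chi> i. (if i = k then -1 else 1) * x$i)"
    define h where "h = (\<lambda>p q (x::real^'n). \<chi> i. if i = p then x$p + x$q else x$i)"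
    have "P (d k)" for k unfolding d_def by (rule stretch)
    moreover have "P (h m n)" "P (h n m)" unfolding h_def using shear[of m n] shear[of n m] that by auto
    ultimately have "P (d n \<circ> (h m n \<circ> (d m \<circ> (h n m \<circ> (d m \<circ> h m n)))))"
      by (simp only: comp)
    moreover have "d n \<circ> (h m n \<circ> (d m \<circ> (h n m \<circ> (d m \<circ> h m n)))) = (\<lambda>x. \<chi> i. x $ Transposition.transpose m n i)"
    proof (rule ext)
      fix x
      have "(d n \<circ> (h m n \<circ> (d m \<circ> (h n m \<circ> (d m \<circ> h m n))))) x $ i = x $ Transposition.transpose m n i" for i
        using that by (cases "i = m"; cases "i = n") (simp_all add: d_def h_def)
      then show "(d n \<circ> (h m n \<circ> (d m \<circ> (h n m \<circ> (d m \<circ> h m n))))) x = (\<chi> i. x $ Transposition.transpose m n i)"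
        by (simp add: vec_eq_iff)
    qed
    ultimately show ?thesis by simp
  qed
  have sing: "P f" if "linear f" and 0: "\<And>x. f x $ i = 0" for f i
  proof -
    have "\<not> inj f"
      using that by (metis (full_types) linear_injective_imp_surjective one_neq_zero surjE vec_component)
    then have "negligible (f ` S)" "det (matrix f) = 0" for S
      using negligible_linear_singular_image[OF \<open>linear f\<close>] det_nz_iff_inj[OF \<open>linear f\<close>] by auto
    then show ?thesis
      using \<open>linear f\<close> by (simp add: P_def negligible_imp_measurable negligible_imp_measure0)
  qed
  have "P f"
  proof (rule induct_linear_elementary[OF \<open>linear f\<close>])
    fix f g :: "real^'n \<Rightarrow> real^'n" assume "P f" "P g"
    then show "P (f \<circ> g)" by (rule comp)
  next
    fix f :: "real^'n \<Rightarrow> real^'n" and i assume "linear f" "\<And>x. f x $ i = 0"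
    then show "P f" by (rule sing)
  qed (fact stretch swap shear)+
  then show ?thesis using assms by (simp add: P_def)
qed

section \<open>Polar bodies and affine invariance\<close>

lemma closed_polar_body: "closed (polar_body K z)"
proof -
  have "polar_body K z = (\<Inter>x\<in>K. {y. (y - z) \<bullet> (x - z) \<le> 1})"
    by (auto simp: polar_body_def)
  also have "closed \<dots>"
    by (intro closed_INT ballI closed_Collect_le continuous_intros)
  finally show ?thesis .
qed

lemma polar_body_antimono: "K \<subseteq> L \<Longrightarrow> polar_body L z \<subseteq> polar_body K z"
  by (auto simp: polar_body_def)

lemma polar_body_convex_hull: "polar_body (convex hull S) z = polar_body S z"
proof
  show "polar_body S z \<subseteq> polar_body (convex hull S) z"
  proof
    fix y assume "y \<in> polar_body S z"
    then have "S \<subseteq> {x. (y - z) \<bullet> x \<le> 1 + (y - z) \<bullet> z}"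
      by (auto simp: polar_body_def inner_diff_right)
    then have "convex hull S \<subseteq> {x. (y - z) \<bullet> x \<le> 1 + (y - z) \<bullet> z}"
      by (intro hull_minimal convex_halfspace_le)
    then show "y \<in> polar_body (convex hull S) z"
      by (auto simp: polar_body_def inner_diff_right)
  qed
qed (simp add: polar_body_antimono hull_subset)

text \<open>
  The support function of a set containing a ball of radius \<open>r\<close> about \<open>z\<close> is, measured from \<open>z\<close>, at
  least \<open>r\<close> times the norm. Bounds on polars and the stability of interior points both come from this.
\<close>
lemma norm_le_of_inner_le_on_cball:
  assumes "cball z r \<subseteq> K" "r \<ge> 0" "\<And>x. x \<in> K \<Longrightarrow> w \<bullet> (x - z) \<le> c"
  shows "r * norm w \<le> c"
proof (cases "w = 0")
  case True
  then show ?thesis using assms(3)[of z] assms(1,2) by (auto simp: subset_iff)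
next
  case False
  have "z + (r / norm w) *\<^sub>R w \<in> K"
    using assms(1,2) False by (auto simp: subset_iff dist_norm)
  from assms(3)[OF this] show ?thesis
    using False by (simp add: dot_square_norm power2_eq_square)
qed

lemma polar_body_subset_cball:
  assumes "cball z r \<subseteq> K" "r > 0"
  shows "polar_body K z \<subseteq> cball z (1 / r)"
proof
  fix y assume "y \<in> polar_body K z"
  then have "r * norm (y - z) \<le> 1"
    using assms by (intro norm_le_of_inner_le_on_cball[of z r K]) (auto simp: polar_body_def)
  then show "y \<in> cball z (1 / r)"
    using \<open>r > 0\<close> by (simp add: dist_norm norm_minus_commute field_simps)
qed

lemma cball_subset_polar_body:
  assumes "K \<subseteq> cball z D" "D > 0"
  shows "cball z (1 / D) \<subseteq> polar_body K z"
proof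
  fix y assume y: "y \<in> cball z (1 / D)"
  have "(y - z) \<bullet> (x - z) \<le> 1" if "x \<in> K" for x
  proof -
    have "(y - z) \<bullet> (x - z) \<le> norm (y - z) * norm (x - z)"
      by (rule norm_cauchy_schwarz)
    also have "\<dots> \<le> (1 / D) * D"
      using y that assms by (intro mult_mono) (auto simp: dist_norm norm_minus_commute subset_iff)
    finally show ?thesis using \<open>D > 0\<close> by simp
  qed
  then show "y \<in> polar_body K z" by (simp add: polar_body_def)
qed

lemma compact_polar_body:
  assumes "z \<in> interior K"
  shows "compact (polar_body K z)"
proof -
  obtain r where "r > 0" "cball z r \<subseteq> K"
    using assms mem_interior_cball by blast
  then have "bounded (polar_body K z)"
    using polar_body_subset_cball by (metis bounded_cball bounded_subset)
  then show ?thesis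
    by (simp add: closed_polar_body compact_eq_bounded_closed)
qed

lemma lmeasurable_polar_body:
  assumes "z \<in> interior K"
  shows "polar_body K z \<in> lmeasurable"
  using assms by (intro lmeasurable_compact compact_polar_body)

lemma volume_product_le:
  assumes "z \<in> interior K"
  shows "volume_product K \<le> measure lebesgue K * measure lebesgue (polar_body K z)"
  unfolding volume_product_def
  by (intro cINF_lower bdd_belowI2[where m = 0]) (simp_all add: assms)

lemma le_volume_product:
  assumes "interior K \<noteq> {}"
    and "\<And>z. z \<in> interior K \<Longrightarrow> c \<le> measure lebesgue K * measure lebesgue (polar_body K z)"
  shows "c \<le> volume_product K"
  unfolding volume_product_def using assms by (rule cINF_greatest)

text \<open>
  Both the body and its polar change volume by the factor \<open>\<bar>det A\<bar>\<close>, in opposite directions, because the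
  polar is transformed by the inverse transpose. Hence the products over corresponding centers agree.
  Of the resulting equality only this direction is stated: normalizing may not lose volume product.
\<close>
lemma volume_product_affine_image_le:
  fixes A :: "real^'n^'n" and a :: "real^'n"
  defines "f \<equiv> \<lambda>y. a + A *v y"
  assumes A: "det A \<noteq> 0" and L: "L \<in> lmeasurable" "interior L \<noteq> {}"
  shows "volume_product (f ` L) \<le> volume_product L"
proof (rule le_volume_product[OF L(2)])
  fix z assume z: "z \<in> interior L"
  have inj: "inj ((*v) A)"
    using A by (simp add: inj_matrix_vector_mult invertible_det_nz)
  have "interior (f ` L) = f ` interior L"
  proof -
    have "f ` S = (+) a ` (*v) A ` S" for S by (auto simp: f_def)
    then show ?thesis
      using inj by (simp add: interior_translation interior_injective_linear_image)
  qed
  with z have fz: "f z \<in> interior (f ` L)" by auto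
  have vol: "measure lebesgue (f ` L) = \<bar>det A\<bar> * measure lebesgue L"
  proof -
    have "f ` L = (+) a ` (*v) A ` L" by (auto simp: f_def)
    then show ?thesis
      using measure_linear_image_cart[of "(*v) A" L] L
      by (simp add: measure_translation)
  qed
  \<comment> \<open>The map \<open>g\<close> is the transpose of \<open>A\<close>.\<close>
  obtain g :: "real^'n \<Rightarrow> real^'n" where g: "linear g" "surj g" "\<bar>det (matrix g)\<bar> = \<bar>det A\<bar>"
    and adj: "y \<bullet> (A *v x) = g y \<bullet> x" for x y
  proof
    show "y \<bullet> (A *v x) = (transpose A *v y) \<bullet> x" for x y
      by (simp add: dot_lmul_matrix)
    show "linear ((*v) (transpose A))" "\<bar>det (matrix ((*v) (transpose A)))\<bar> = \<bar>det A\<bar>"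
      by (rule matrix_vector_mul_linear) (simp only: matrix_of_matrix_vector_mul det_transpose)
    show "surj ((*v) (transpose A))"
      using A by (metis det_transpose invertible_det_nz invertible_eq_bij bij_is_surj)
  qed
  have polar: "polar_body L z = (+) (z - g (f z)) ` g ` polar_body (f ` L) (f z)"
  proof -
    have "f x - f z = A *v (x - z)" for x
      by (simp add: f_def matrix_vector_mult_diff_distrib)
    then have "(y - f z) \<bullet> (f x - f z) = g (y - f z) \<bullet> (x - z)" for x y
      by (simp add: adj)
    then have mem: "z + g (y - f z) \<in> polar_body L z \<longleftrightarrow> y \<in> polar_body (f ` L) (f z)" for y
      by (simp add: polar_body_def)
    have "x \<in> (\<lambda>y. z + g (y - f z)) ` polar_body (f ` L) (f z)" if "x \<in> polar_body L z" for x
    proof -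
      obtain w where "x - z = g w"
        using surjD[OF \<open>surj g\<close>, of "x - z"] by auto
      then have "x = z + g ((w + f z) - f z)" by (simp add: algebra_simps)
      with that mem[of "w + f z"] show ?thesis by blast
    qed
    then have "polar_body L z = (\<lambda>y. z + g (y - f z)) ` polar_body (f ` L) (f z)"
      using mem by blast
    also have "\<dots> = (+) (z - g (f z)) ` g ` polar_body (f ` L) (f z)"
      unfolding image_image by (intro image_cong refl) (simp add: linear_diff[OF \<open>linear g\<close>])
    finally show ?thesis .
  qed
  have "measure lebesgue (polar_body L z) = \<bar>det A\<bar> * measure lebesgue (polar_body (f ` L) (f z))"
    unfolding polar
    using measure_linear_image_cart[OF \<open>linear g\<close> lmeasurable_polar_body[OF fz]] g(3)
    by (simp add: measure_translation)
  then show "volume_product (f ` L) \<le> measure lebesgue L * measure lebesgue (polar_body L z)"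
    using volume_product_le[OF fz] vol by (simp add: mult.left_commute mult.commute)
qed

section \<open>Normalizing a polytope\<close>

lemma full_dimensional_nonsingular_edges:
  fixes V :: "(real^'n) set"
  assumes "interior (convex hull V) \<noteq> {}" "a \<in> V"
  obtains w :: "'n \<Rightarrow> real^'n" where "\<And>j. w j \<in> V" "det (\<chi> i j. (w j - a) $ i) \<noteq> 0"
proof -
  let ?E = "(+) (- a) ` V"
  have "aff_dim V = int (dim ?E)"
    using \<open>a \<in> V\<close> by (intro aff_dim_eq_dim) (simp add: hull_inc)
  moreover have "aff_dim V = int (DIM(real^'n))"
    using aff_dim_nonempty_interior[OF assms(1)] by (simp add: aff_dim_convex_hull)
  ultimately have "span ?E = UNIV"
    by (metis dim_eq_full of_nat_eq_iff)
  then obtain B where B: "B \<subseteq> ?E" "independent B" "span B = UNIV"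
    using maximal_independent_subset[of ?E] by (metis span_mono span_span top.extremum_uniqueI)
  then have "finite B" "card B = CARD('n)"
    using independent_imp_finite basis_card_eq_dim[of B UNIV] by (auto simp: dim_UNIV)
  then obtain h :: "'n \<Rightarrow> real^'n" where h: "bij_betw h UNIV B"
    using finite_same_card_bij[of "UNIV :: 'n set" B] by auto
  let ?A = "\<chi> i j. h j $ i"
  have "columns ?A = B"
    using h by (auto simp: columns_def column_def bij_betw_def)
  then have "\<exists>M. ?A ** M = mat 1"
    using B by (simp add: matrix_right_invertible_span_columns span_vec_eq)
  then have "det ?A \<noteq> 0"
    by (metis invertible_det_nz invertible_right_inverse)
  moreover have "h j + a \<in> V" for j
  proof -
    have "h j \<in> (+) (- a) ` V" using bij_betwE[OF h] B(1) by auto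
    then show ?thesis by auto
  qed
  ultimately show ?thesis
    by (intro that[of "\<lambda>j. h j + a"]) auto
qed

text \<open>
  Among all simplices spanned by \<open>a\<close> and points of \<open>V\<close>, one of largest volume is taken as the
  coordinate frame. By Cramer's rule each coordinate of a point \<open>v\<close> of \<open>V\<close> is a quotient of two such
  determinants, the numerator belonging to the simplex with one vertex replaced by \<open>v\<close>, so maximality
  bounds it by 1.
\<close>
lemma normalizing_affine_map:
  fixes V :: "(real^'n) set"
  assumes "finite V" "interior (convex hull V) \<noteq> {}"
  obtains a A c where "det A \<noteq> 0" "\<And>v. v \<in> V \<Longrightarrow> a + A *v c v = v"
    "\<And>v k. v \<in> V \<Longrightarrow> \<bar>c v $ k\<bar> \<le> 1" "insert 0 Basis \<subseteq> c ` V"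
proof -
  obtain a where a: "a \<in> V" using assms(2) by fastforce
  define W where "W = {w :: 'n \<Rightarrow> real^'n. \<forall>j. w j \<in> V}"
  define M where "M w = (\<chi> i j. (w j - a) $ i)" for w :: "'n \<Rightarrow> real^'n"
  have "finite W"
    using finite_PiE[of "UNIV :: 'n set" "\<lambda>_. V"] \<open>finite V\<close> by (simp add: W_def PiE_UNIV_domain Pi_def)
  obtain w0 where w0: "w0 \<in> W" "det (M w0) \<noteq> 0"
    using full_dimensional_nonsingular_edges[OF assms(2) a] by (auto simp: W_def M_def)
  obtain w where w: "w \<in> W" "\<bar>det (M w)\<bar> = Max ((\<lambda>w. \<bar>det (M w)\<bar>) ` W)"
    using obtains_MAX[OF \<open>finite W\<close>] w0 by (metis empty_iff)
  have max: "\<bar>det (M v)\<bar> \<le> \<bar>det (M w)\<bar>" if "v \<in> W" for v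
    using that w(2) \<open>finite W\<close> by simp
  let ?A = "M w"
  have d: "det ?A \<noteq> 0" using max[OF w0(1)] w0(2) by auto
  then have inj: "inj ((*v) ?A)"
    by (simp add: inj_matrix_vector_mult invertible_det_nz)
  define c where "c v = (\<chi> k. det (\<chi> i j. if j = k then (v - a) $ i else ?A $ i $ j) / det ?A)" for v
  have c: "?A *v c v = v - a" for v
    using cramer[OF d] by (simp add: c_def)
  have small: "\<bar>c v $ k\<bar> \<le> 1" if "v \<in> V" for v k
  proof -
    have "(\<chi> i j. if j = k then (v - a) $ i else ?A $ i $ j) = M (w(k := v))"
      by (simp add: M_def vec_eq_iff)
    moreover have "w(k := v) \<in> W" using that w(1) by (simp add: W_def)
    ultimately show ?thesis
      using max d by (simp add: c_def)
  qed
  have c0: "c a = 0"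
    using injD[OF inj, of "c a" 0] by (simp add: c)
  have cw: "c (w j) = axis j 1" for j
  proof (rule injD[OF inj])
    show "?A *v c (w j) = ?A *v axis j 1"
      unfolding c by (simp add: vec_eq_iff M_def matrix_vector_mult_basis column_def)
  qed
  have "insert 0 Basis \<subseteq> c ` V"
  proof (intro insert_subsetI subsetI)
    show "0 \<in> c ` V" using c0 a by (metis imageI)
    fix b :: "real^'n" assume "b \<in> Basis"
    then obtain j where "b = axis j 1" by (auto simp: Basis_vec_def)
    moreover have "w j \<in> V" using w(1) by (simp add: W_def)
    ultimately show "b \<in> c ` V" using cw by (metis imageI)
  qed
  then show ?thesis
    using that[of ?A a c] d c small by simp
qed

lemma finite_range_enumeration:
  assumes "finite V" "V \<noteq> {}" "card V \<le> m"
  obtains x :: "nat \<Rightarrow> 'a" where "x ` {..<m} = V" "range x = V"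
proof -
  obtain h where h: "bij_betw h {0..<card V} V"
    using ex_bij_betw_nat_finite[OF \<open>finite V\<close>] by blast
  obtain v where "v \<in> V" using \<open>V \<noteq> {}\<close> by blast
  let ?x = "\<lambda>i. if i < card V then h i else v"
  have sub: "range ?x \<subseteq> V"
    using h \<open>v \<in> V\<close> by (auto simp: bij_betw_def)
  have "V \<subseteq> ?x ` {..<m}"
  proof
    fix u assume "u \<in> V"
    then obtain i where "i < card V" "u = h i"
      using bij_betw_imp_surj_on[OF h] by force
    then show "u \<in> ?x ` {..<m}" using \<open>card V \<le> m\<close> by (intro image_eqI[of _ _ i]) auto
  qed
  with sub show ?thesis by (intro that[of ?x]) blast+
qed

lemma polytope_eq_hull_vertices:
  assumes "K \<in> polytopes_at_most m"
  shows "finite (vertices K)" "card (vertices K) \<le> m" "K = convex hull vertices K" "interior K \<noteq> {}"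
  using assms Krein_Milman_Minkowski[OF polytope_imp_compact polytope_imp_convex]
  by (auto simp: polytopes_at_most_def finite_polyhedron_extreme_points polytope_imp_polyhedron)

lemma convex_hull_mem_polytopes_at_most:
  assumes "finite S" "card S \<le> m" "interior (convex hull S) \<noteq> {}"
  shows "convex hull S \<in> polytopes_at_most m"
proof -
  have "card (vertices (convex hull S)) \<le> card S"
    using assms(1) by (intro card_mono extreme_points_of_convex_hull)
  with assms show ?thesis
    by (auto simp: polytopes_at_most_def polytope_convex_hull)
qed

text \<open>
  Polytopes are represented by tuples of \<open>m\<close> points, possibly with repetition, so that polytopes with
  fewer vertices are included and limits can be taken point by point. The standard simplex inside keeps
  the limit from degenerating.
\<close>
lemma normalized_representative:
  fixes K :: "(real^'n) set"
  assumes "K \<in> polytopes_at_most m"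
  obtains x :: "nat \<Rightarrow> real^'n" where "\<And>i. x i \<in> cball 0 (real CARD('n))"
    "insert 0 Basis \<subseteq> x ` {..<m}" "volume_product K \<le> volume_product (convex hull (x ` {..<m}))"
proof -
  define V where "V = vertices K"
  have V: "finite V" "card V \<le> m" "K = convex hull V" "interior (convex hull V) \<noteq> {}"
    using polytope_eq_hull_vertices[OF assms] by (simp_all add: V_def)
  obtain a A c where A: "det A \<noteq> 0" and c: "\<And>v. v \<in> V \<Longrightarrow> a + A *v c v = v"
    "\<And>v k. v \<in> V \<Longrightarrow> \<bar>c v $ k\<bar> \<le> 1" and std: "insert 0 Basis \<subseteq> c ` V"
    using normalizing_affine_map[OF V(1,4)] by metis
  have "V \<noteq> {}" using V(4) by auto
  then obtain x where x: "x ` {..<m} = c ` V" "range x = c ` V"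
    using finite_range_enumeration[of "c ` V" m] V(1,2) card_image_le[of V c] by force
  let ?L = "convex hull (c ` V)"
  have "(\<lambda>y. a + A *v y) ` ?L = (+) a ` (*v) A ` ?L"
    by (simp add: image_image)
  also have "\<dots> = convex hull ((+) a ` (*v) A ` c ` V)"
    by (simp add: convex_hull_linear_image convex_hull_translation)
  also have "(+) a ` (*v) A ` c ` V = V"
    using c(1) by (force simp: image_image)
  finally have K: "K = (\<lambda>y. a + A *v y) ` ?L" using V(3) by simp
  have "convex hull (insert 0 Basis) \<subseteq> ?L" by (rule hull_mono[OF std])
  then have "interior ?L \<noteq> {}"
    by (metis interior_mono interior_std_simplex_nonempty ex_in_conv subset_iff)
  moreover have "compact ?L" using V(1) by (simp add: finite_imp_compact_convex_hull)
  ultimately have le: "volume_product K \<le> volume_product ?L"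
    unfolding K using A by (intro volume_product_affine_image_le) (auto intro: lmeasurable_compact)
  have "norm (c v) \<le> real CARD('n)" if "v \<in> V" for v
  proof -
    have "norm (c v) \<le> (\<Sum>k\<in>UNIV. \<bar>c v $ k\<bar>)" by (rule norm_le_l1_cart)
    also have "\<dots> \<le> (\<Sum>k\<in>(UNIV :: 'n set). 1)" using c(2)[OF that] by (intro sum_mono)
    finally show ?thesis by simp
  qed
  then have "x i \<in> cball 0 (real CARD('n))" for i
    using x(2) by (metis imageE mem_cball_0 rangeI)
  then show ?thesis
    using that[of x] x(1) std le by simp
qed

section \<open>Upper semicontinuity of the volume product\<close>

lemma convex_hull_near:
  fixes x y :: "'i \<Rightarrow> 'a::real_normed_vector"
  assumes "\<And>i. i \<in> I \<Longrightarrow> dist (x i) (y i) \<le> d" "p \<in> convex hull (x ` I)"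
  obtains q where "q \<in> convex hull (y ` I)" "dist p q \<le> d"
proof -
  let ?N = "\<Union>q\<in>convex hull (y ` I). \<Union>e\<in>cball 0 d. {q + e}"
  have "x ` I \<subseteq> ?N"
  proof clarsimp
    fix i assume "i \<in> I"
    then have "y i \<in> convex hull (y ` I)" "norm (x i - y i) \<le> d"
      using assms(1)[of i] by (auto simp: dist_norm hull_inc)
    then show "\<exists>q\<in>convex hull (y ` I). \<exists>e\<in>cball 0 d. x i = q + e"
      by (metis add.commute diff_add_cancel mem_cball_0)
  qed
  moreover have "convex ?N" by (intro convex_sums convex_convex_hull convex_cball)
  ultimately have "p \<in> ?N" using assms(2) hull_minimal[of "x ` I" ?N convex] by blast
  then obtain q e where "q \<in> convex hull (y ` I)" "norm e \<le> d" "p = q + e" by auto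
  then show ?thesis by (intro that[of q]) (auto simp: dist_norm)
qed

text \<open>
  If a point \<open>q\<close> close to \<open>z\<close> were not in \<open>L\<close>, a hyperplane would separate it from \<open>L\<close>, and \<open>K\<close> could
  stick out beyond that hyperplane by at most \<open>d\<close>, whereas \<open>K\<close> contains a ball of larger radius about \<open>z\<close>.
\<close>
lemma interior_of_near:
  fixes L :: "'a::euclidean_space set"
  assumes "convex L" "closed L" "cball z r \<subseteq> K" "0 \<le> d" "d < r"
    and near: "\<And>x. x \<in> K \<Longrightarrow> \<exists>y\<in>L. dist x y \<le> d"
  shows "z \<in> interior L"
proof -
  have "q \<in> L" if q: "q \<in> ball z (r - d)" for q
  proof (rule ccontr)
    assume "q \<notin> L"
    then obtain a b where ab: "a \<bullet> q < b" "\<And>y. y \<in> L \<Longrightarrow> b < a \<bullet> y"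
      using separating_hyperplane_closed_point[OF assms(1,2)] by blast
    have "(- a) \<bullet> (x - z) \<le> a \<bullet> (z - q) + d * norm a" if "x \<in> K" for x
    proof -
      obtain y where y: "y \<in> L" "dist x y \<le> d" using near[OF \<open>x \<in> K\<close>] by blast
      have "a \<bullet> (y - x) \<le> norm a * norm (y - x)" by (rule norm_cauchy_schwarz)
      also have "\<dots> \<le> norm a * d"
        using y(2) by (intro mult_left_mono) (auto simp: dist_norm norm_minus_commute)
      finally show ?thesis
        using ab(1) ab(2)[OF y(1)] by (simp add: inner_diff_right algebra_simps)
    qed
    then have "r * norm (- a) \<le> a \<bullet> (z - q) + d * norm a"
      using assms by (intro norm_le_of_inner_le_on_cball[of z r K]) auto
    then have "(r - d) * norm a \<le> a \<bullet> (z - q)" by (simp add: algebra_simps)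
    also have "\<dots> \<le> norm a * norm (z - q)" by (rule norm_cauchy_schwarz)
    finally have "a = 0" using q by (simp add: dist_norm mult.commute mult_le_cancel_left split: if_splits)
    moreover obtain y where "y \<in> L" using near[of z] assms(3,4,5) by (auto simp: subset_iff)
    ultimately show False using ab(1) ab(2)[of y] by simp
  qed
  then show ?thesis
    using \<open>d < r\<close> by (intro interiorI[of "ball z (r - d)"]) auto
qed

text \<open>
  Since \<open>K\<close> contains the ball of radius \<open>r\<close>, an error of size \<open>e * r\<close> is absorbed by dilating \<open>K\<close> about
  \<open>z\<close> by the factor \<open>1 + e\<close>.
\<close>
lemma volume_le_of_near:
  fixes K L :: "'a::euclidean_space set"
  assumes "compact K" "convex K" "L \<in> sets lebesgue" "cball z r \<subseteq> K" "r > 0" "e > 0"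
    and near: "\<And>y. y \<in> L \<Longrightarrow> \<exists>x\<in>K. dist x y \<le> e * r"
  shows "measure lebesgue L \<le> (1 + e) ^ DIM('a) * measure lebesgue K"
proof -
  let ?f = "\<lambda>x. (1 + e) *\<^sub>R x + (- e) *\<^sub>R z"
  have "L \<subseteq> ?f ` K"
  proof
    fix y assume "y \<in> L"
    then obtain x where x: "x \<in> K" "dist x y \<le> e * r" using near by blast
    \<comment> \<open>Contracting \<open>y\<close> towards \<open>z\<close> by \<open>1 + e\<close> gives a convex combination of \<open>x\<close> and \<open>u\<close>.\<close>
    define u where "u = z + (1 / e) *\<^sub>R (y - x)"
    have "u \<in> K"
    proof -
      have "dist z u \<le> r"
      proof -
        have "dist z u = norm ((1 / e) *\<^sub>R (x - y))"
          by (simp add: u_def dist_norm algebra_simps)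
        also have "\<dots> = dist x y / e"
          using \<open>e > 0\<close> by (simp add: dist_norm)
        finally show ?thesis
          using x(2) \<open>e > 0\<close> by (simp add: divide_le_eq mult.commute)
      qed
      then show ?thesis using assms(4) by auto
    qed
    then have "(1 / (1 + e)) *\<^sub>R x + (e / (1 + e)) *\<^sub>R u \<in> K" (is "?v \<in> K")
      using x(1) \<open>e > 0\<close> by (intro convexD[OF \<open>convex K\<close>]) (auto simp: field_simps)
    moreover have "y = ?f ?v"
    proof -
      have "(1 + e) *\<^sub>R ?v = x + e *\<^sub>R u"
        using \<open>e > 0\<close> by (simp add: scaleR_add_right)
      also have "e *\<^sub>R u = e *\<^sub>R z + (y - x)"
        using \<open>e > 0\<close> by (simp add: u_def scaleR_add_right)
      finally show ?thesis by simp
    qed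
    ultimately show "y \<in> ?f ` K" by blast
  qed
  moreover have "compact (?f ` K)"
    by (intro compact_continuous_image continuous_intros \<open>compact K\<close>)
  ultimately have "measure lebesgue L \<le> measure lebesgue (?f ` K)"
    using assms(3) by (intro measure_mono_fmeasurable lmeasurable_compact)
  also have "\<dots> = (1 + e) ^ DIM('a) * measure lebesgue K"
    using \<open>e > 0\<close> by (subst measure_lebesgue_affine) simp
  finally show ?thesis .
qed

text \<open>
  A functional \<open>w\<close> that is at most 1 on \<open>L\<close> is at most \<open>1 + e * r * norm w\<close> on \<open>K\<close>. The ball in \<open>K\<close> turns
  this into \<open>r * norm w \<le> 1 / (1 - e)\<close>, and so \<open>w\<close> is at most \<open>1 / (1 - e)\<close> on \<open>K\<close>.
\<close>
lemma polar_volume_le_of_near: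
  fixes K L :: "'a::euclidean_space set"
  assumes "cball z r \<subseteq> K" "r > 0" "0 < e" "e < 1"
    and near: "\<And>x. x \<in> K \<Longrightarrow> \<exists>y\<in>L. dist x y \<le> e * r"
  shows "measure lebesgue (polar_body L z) \<le> measure lebesgue (polar_body K z) / (1 - e) ^ DIM('a)"
proof -
  let ?f = "\<lambda>x. (1 / (1 - e)) *\<^sub>R x + (- e / (1 - e)) *\<^sub>R z"
  have z: "z \<in> interior K" using assms(1,2) mem_interior_cball by blast
  have "polar_body L z \<subseteq> ?f ` polar_body K z"
  proof
    fix y assume y: "y \<in> polar_body L z"
    define w where "w = y - z"
    have *: "w \<bullet> (x - z) \<le> 1 + e * (r * norm w)" if "x \<in> K" for x
    proof -
      obtain x' where x': "x' \<in> L" "dist x x' \<le> e * r" using near[OF \<open>x \<in> K\<close>] by blast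
      have "w \<bullet> (x - x') \<le> norm w * norm (x - x')" by (rule norm_cauchy_schwarz)
      also have "\<dots> \<le> norm w * (e * r)"
        using x'(2) by (intro mult_left_mono) (auto simp: dist_norm)
      finally have "w \<bullet> (x - x') \<le> e * (r * norm w)" by (simp add: mult_ac)
      moreover have "w \<bullet> (x' - z) \<le> 1" using y x'(1) by (simp add: polar_body_def w_def)
      ultimately show ?thesis by (simp add: inner_diff_right)
    qed
    then have "r * norm w \<le> 1 + e * (r * norm w)"
      using assms by (intro norm_le_of_inner_le_on_cball[of z r K]) auto
    then have "(1 - e) * (1 + e * (r * norm w)) \<le> 1"
      using mult_left_mono[of "(1 - e) * (r * norm w)" 1 e] \<open>0 < e\<close> by (simp add: algebra_simps)
    then have "((1 - e) *\<^sub>R w) \<bullet> (x - z) \<le> 1" if "x \<in> K" for x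
      using mult_left_mono[OF *[OF that], of "1 - e"] \<open>e < 1\<close> by (simp only: inner_scaleR_left) linarith
    then have "z + (1 - e) *\<^sub>R w \<in> polar_body K z" (is "?v \<in> _")
      by (simp add: polar_body_def)
    moreover have "y = ?f ?v"
    proof -
      have "(1 / (1 - e)) *\<^sub>R ((1 - e) *\<^sub>R w) = w"
        using \<open>e < 1\<close> by simp
      then have "?f ?v = ((1 / (1 - e)) + (- e / (1 - e))) *\<^sub>R z + w"
        by (simp only: scaleR_add_right scaleR_add_left ac_simps)
      also have "(1 / (1 - e)) + (- e / (1 - e)) = 1"
        using \<open>e < 1\<close> by (simp add: field_simps)
      finally show ?thesis by (simp add: w_def)
    qed
    ultimately show "y \<in> ?f ` polar_body K z" by blast
  qed
  moreover have "compact (?f ` polar_body K z)"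
    by (intro compact_continuous_image continuous_intros compact_polar_body z)
  ultimately have "measure lebesgue (polar_body L z) \<le> measure lebesgue (?f ` polar_body K z)"
    using closed_polar_body[of L z] by (intro measure_mono_fmeasurable lmeasurable_compact) auto
  also have "\<dots> = measure lebesgue (polar_body K z) / (1 - e) ^ DIM('a)"
    using \<open>e < 1\<close> by (subst measure_lebesgue_affine) (simp add: power_one_over field_simps)
  finally show ?thesis .
qed

lemma volume_product_le_of_near:
  fixes K L :: "'a::euclidean_space set"
  assumes "compact K" "convex K" "compact L" "convex L" "cball z r \<subseteq> K" "r > 0" "0 < e" "e < 1"
    and "\<And>x. x \<in> K \<Longrightarrow> \<exists>y\<in>L. dist x y \<le> e * r"
    and "\<And>y. y \<in> L \<Longrightarrow> \<exists>x\<in>K. dist x y \<le> e * r"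
  shows "volume_product L \<le> ((1 + e) / (1 - e)) ^ DIM('a) *
           (measure lebesgue K * measure lebesgue (polar_body K z))"
proof -
  have "z \<in> interior L"
    using assms by (intro interior_of_near[of L z r K "e * r"]) (auto simp: compact_imp_closed)
  then have "volume_product L \<le> measure lebesgue L * measure lebesgue (polar_body L z)"
    by (rule volume_product_le)
  also have "\<dots> \<le> ((1 + e) ^ DIM('a) * measure lebesgue K) * (measure lebesgue (polar_body K z) / (1 - e) ^ DIM('a))"
    using assms by (intro mult_mono volume_le_of_near[of K L z r] polar_volume_le_of_near[of z r K])
      (auto simp: compact_imp_closed)
  finally show ?thesis by (simp add: power_divide mult_ac)
qed

section \<open>Existence of a maximizer\<close>

lemma bounded_tuples_convergent_subseq:
  fixes X :: "nat \<Rightarrow> nat \<Rightarrow> 'a::metric_space"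
  assumes "compact S" "\<And>j i. X j i \<in> S"
  shows "\<exists>r l. strict_mono r \<and> (\<forall>i<m. (\<lambda>j. X (r j) i) \<longlonglongrightarrow> l i)"
proof (induction m)
  case 0
  then show ?case by (auto intro: exI[of _ id] simp: strict_mono_id)
next
  case (Suc m)
  then obtain r l where r: "strict_mono r" "\<And>i. i < m \<Longrightarrow> (\<lambda>j. X (r j) i) \<longlonglongrightarrow> l i" by blast
  have "\<forall>j. X (r j) m \<in> S" using assms(2) by blast
  then obtain l' r' where r': "strict_mono r'" "((\<lambda>j. X (r j) m) \<circ> r') \<longlonglongrightarrow> l'"
    using \<open>compact S\<close> unfolding compact_def by metis
  have "(\<lambda>j. X ((r \<circ> r') j) i) \<longlonglongrightarrow> (l(m := l')) i" if "i < Suc m" for i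
    using that r' LIMSEQ_subseq_LIMSEQ[OF r(2) r'(1), of i] by (cases "i = m") (auto simp: o_def)
  with r r' show ?case by (blast intro: strict_mono_o)
qed

text \<open>
  For a fixed center \<open>z\<close> interior to the limit body, eventually all bodies of the sequence are as close
  to it as the semicontinuity estimate demands; letting \<open>e\<close> tend to 0 bounds \<open>s\<close> by the value at \<open>z\<close>, and
  the infimum over \<open>z\<close> is the volume product. The bound \<open>s\<close> is an extended real, so finiteness of the
  supremum is a consequence.
\<close>
lemma volume_product_limit_of_tuples:
  fixes X :: "nat \<Rightarrow> nat \<Rightarrow> 'a::euclidean_space"
  assumes conv: "\<And>i. i < m \<Longrightarrow> (\<lambda>j. X j i) \<longlonglongrightarrow> l i"
    and T: "\<And>j. T \<subseteq> convex hull (X j ` {..<m})" "interior T \<noteq> {}"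
    and s: "(\<lambda>j. ereal (c j)) \<longlonglongrightarrow> s" "\<And>j. c j \<le> volume_product (convex hull (X j ` {..<m}))"
  shows "interior (convex hull (l ` {..<m})) \<noteq> {}" "s \<le> ereal (volume_product (convex hull (l ` {..<m})))"
proof -
  let ?K = "convex hull (l ` {..<m})" and ?L = "\<lambda>j. convex hull (X j ` {..<m})"
  have comp: "compact ?K" "compact (?L j)" for j
    by (simp_all add: finite_imp_compact_convex_hull)
  have ev: "\<forall>\<^sub>F j in sequentially. \<forall>i<m. dist (X j i) (l i) \<le> d" if "d > 0" for d
  proof -
    have "\<forall>\<^sub>F j in sequentially. dist (X j i) (l i) < d" if "i < m" for i
      using conv[OF that] \<open>d > 0\<close> by (rule tendstoD)
    then have "\<forall>\<^sub>F j in sequentially. \<forall>i\<in>{..<m}. dist (X j i) (l i) < d"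
      by (intro eventually_ball_finite) auto
    then show ?thesis by eventually_elim (auto intro: less_imp_le)
  qed
  have "T \<subseteq> ?K"
  proof
    fix p assume "p \<in> T"
    have "\<exists>q\<in>?K. dist q p < d" if "d > 0" for d
    proof -
      have "\<forall>\<^sub>F j in sequentially. \<forall>i<m. dist (X j i) (l i) \<le> d / 2"
        by (rule ev) (use \<open>d > 0\<close> in simp)
      then obtain j where j: "\<forall>i<m. dist (X j i) (l i) \<le> d / 2"
        using eventually_happens'[OF sequentially_bot] by blast
      have "p \<in> ?L j" using \<open>p \<in> T\<close> T(1) by blast
      then obtain q where "q \<in> ?K" "dist p q \<le> d / 2"
        using convex_hull_near[of "{..<m}" "X j" l "d / 2" p] j by auto
      with \<open>d > 0\<close> show ?thesis by (auto simp: dist_commute intro!: bexI[of _ q])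
    qed
    then have "p \<in> closure ?K" by (simp add: closure_approachable)
    then show "p \<in> ?K" using comp(1) by (simp add: compact_imp_closed)
  qed
  then show int: "interior ?K \<noteq> {}" using T(2) interior_mono[OF \<open>T \<subseteq> ?K\<close>] by auto
  have le: "s \<le> ereal (measure lebesgue ?K * measure lebesgue (polar_body ?K z))" (is "_ \<le> ereal ?V")
    if "z \<in> interior ?K" for z
  proof -
    obtain r where r: "r > 0" "cball z r \<subseteq> ?K"
      using \<open>z \<in> interior ?K\<close> mem_interior_cball[of z ?K] by metis
    have bound: "s \<le> ereal (((1 + e) / (1 - e)) ^ DIM('a) * ?V)" if e: "0 < e" "e < 1" for e
    proof (rule tendsto_upperbound[OF s(1)])
      have "\<forall>\<^sub>F j in sequentially. \<forall>i<m. dist (X j i) (l i) \<le> e * r"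
        using ev e r by simp
      then show "\<forall>\<^sub>F j in sequentially. ereal (c j) \<le> ereal (((1 + e) / (1 - e)) ^ DIM('a) * ?V)"
      proof eventually_elim
        case (elim j)
        have "volume_product (?L j) \<le> ((1 + e) / (1 - e)) ^ DIM('a) * ?V"
        proof (rule volume_product_le_of_near)
          show "\<exists>y\<in>?L j. dist x y \<le> e * r" if "x \<in> ?K" for x
            using convex_hull_near[OF _ that, of "X j" "e * r"] elim by (auto simp: dist_commute)
          show "\<exists>x\<in>?K. dist x y \<le> e * r" if "y \<in> ?L j" for y
            using convex_hull_near[OF _ that, of l "e * r"] elim by (auto simp: dist_commute)
        qed (use comp r e in auto)
        with s(2)[of j] show ?case by simp
      qed
    qed simp
    show ?thesis
    proof (rule tendsto_lowerbound)
      have "((\<lambda>e. ((1 + e) / (1 - e)) ^ DIM('a) * ?V) \<longlongrightarrow> ((1 + 0) / (1 - 0)) ^ DIM('a) * ?V) (at_right 0)"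
        by (intro tendsto_intros) auto
      then show "((\<lambda>e. ereal (((1 + e) / (1 - e)) ^ DIM('a) * ?V)) \<longlongrightarrow> ereal ?V) (at_right 0)"
        by simp
      have "\<forall>\<^sub>F e in at_right 0. e \<in> {0<..<1::real}"
        by (rule eventually_at_right_real) simp
      then show "\<forall>\<^sub>F e in at_right 0. s \<le> ereal (((1 + e) / (1 - e)) ^ DIM('a) * ?V)"
        by eventually_elim (use bound in auto)
    qed simp
  qed
  show "s \<le> ereal (volume_product ?K)"
  proof (cases s)
    case (real v)
    with le show ?thesis by (auto intro!: le_volume_product int)
  qed (use int le in auto)
qed

lemma std_simplex_mem_polytopes_at_most:
  assumes "DIM('a::euclidean_space) + 1 \<le> m"
  shows "convex hull (insert 0 Basis :: 'a set) \<in> polytopes_at_most m"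
proof (rule convex_hull_mem_polytopes_at_most)
  show "card (insert 0 Basis :: 'a set) \<le> m"
    using assms card_insert_le_m1[of "DIM('a) + 1" "Basis :: 'a set" 0] by simp
  show "interior (convex hull (insert 0 Basis :: 'a set)) \<noteq> {}"
    by (metis empty_iff interior_std_simplex_nonempty)
qed simp

theorem volume_product_maximizer_exists:
  assumes "CARD('n::finite) + 1 \<le> m"
  obtains K :: "(real^'n) set" where "K \<in> polytopes_at_most m"
    "ereal (volume_product K) = max_volume_product TYPE(real^'n) m"
proof -
  let ?P = "polytopes_at_most m :: (real^'n) set set"
  let ?M = "max_volume_product TYPE(real^'n) m"
  let ?T = "convex hull (insert 0 Basis :: (real^'n) set)"
  have "?T \<in> ?P" using std_simplex_mem_polytopes_at_most[where 'a = "real^'n"] assms by simp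
  then have "(\<lambda>K. ereal (volume_product K)) ` ?P \<noteq> {}" by blast
  from Sup_countable_SUP[OF this] obtain f :: "nat \<Rightarrow> ereal"
    where f: "incseq f" "range f \<subseteq> (\<lambda>K. ereal (volume_product K)) ` ?P" "?M = (SUP j. f j)"
    unfolding max_volume_product_def by blast
  have lim: "f \<longlonglongrightarrow> ?M" unfolding f(3) using f(1) by (rule LIMSEQ_SUP)
  have "\<exists>K. K \<in> ?P \<and> f j = ereal (volume_product K)" for j using f(2) by blast
  then obtain K where K: "\<And>j. K j \<in> ?P" "\<And>j. f j = ereal (volume_product (K j))" by metis
  define Q where "Q j x \<longleftrightarrow> (\<forall>i. x i \<in> cball 0 (real CARD('n))) \<and> insert 0 Basis \<subseteq> x ` {..<m} \<and>
      volume_product (K j) \<le> volume_product (convex hull (x ` {..<m}))" for j and x :: "nat \<Rightarrow> real^'n"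
  have "\<exists>x. Q j x" for j
    unfolding Q_def by (rule normalized_representative[OF K(1)[of j]]) (intro exI conjI allI)
  then obtain X where "\<And>j. Q j (X j)" by metis
  then have X: "\<And>j i. X j i \<in> cball 0 (real CARD('n))" "\<And>j. insert 0 Basis \<subseteq> X j ` {..<m}"
      "\<And>j. volume_product (K j) \<le> volume_product (convex hull (X j ` {..<m}))"
    by (simp_all add: Q_def)
  obtain r l where r: "strict_mono r" and l: "\<And>i. i < m \<Longrightarrow> (\<lambda>j. X (r j) i) \<longlonglongrightarrow> l i"
    using bounded_tuples_convergent_subseq[where X = X and m = m, OF compact_cball X(1)] by metis
  let ?K = "convex hull (l ` {..<m})"
  have limit: "interior ?K \<noteq> {}" "?M \<le> ereal (volume_product ?K)"
  proof (atomize (full), intro conjI)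
    have T: "?T \<subseteq> convex hull (X (r j) ` {..<m})" for j by (rule hull_mono[OF X(2)])
    have T': "interior ?T \<noteq> {}" by (metis empty_iff interior_std_simplex_nonempty)
    have s: "(\<lambda>j. ereal (volume_product (K (r j)))) \<longlonglongrightarrow> ?M"
      using LIMSEQ_subseq_LIMSEQ[OF lim r] by (simp add: o_def K(2))
    show "interior ?K \<noteq> {}" "?M \<le> ereal (volume_product ?K)"
      using volume_product_limit_of_tuples[of m "\<lambda>j. X (r j)", OF l T T' s X(3)] by auto
  qed
  have "card (l ` {..<m}) \<le> m" using card_image_le[of "{..<m}" l] by simp
  then have mem: "?K \<in> ?P" by (intro convex_hull_mem_polytopes_at_most limit(1)) auto
  then have "ereal (volume_product ?K) \<le> ?M" unfolding max_volume_product_def by (rule SUP_upper)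
  with limit(2) mem show ?thesis by (intro that[of ?K]) auto
qed

section \<open>Adding an apex over a facet: gain of volume\<close>

lemma facet_disc:
  fixes K :: "'a::euclidean_space set"
  assumes "polytope K" "interior K \<noteq> {}"
  obtains p u r where "norm u = 1" "r > 0" "\<And>x. x \<in> K \<Longrightarrow> u \<bullet> x \<le> u \<bullet> p"
    "\<And>w. u \<bullet> w = 0 \<Longrightarrow> norm w \<le> r \<Longrightarrow> p + w \<in> K"
proof -
  have dim: "aff_dim K = int (DIM('a))" by (rule aff_dim_nonempty_interior[OF assms(2)])
  then obtain F where F: "F facet_of K"
    using polytope_facet_exists[OF assms(1)] by (metis DIM_positive of_nat_0_less_iff)
  obtain a b where ab: "a \<noteq> 0" "K \<subseteq> {x. a \<bullet> x \<le> b}" "F = K \<inter> {x. a \<bullet> x = b}"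
    by (rule facet_of_polyhedron[OF polytope_imp_polyhedron[OF assms(1)] F])
  have "affine hull F \<subseteq> {x. a \<bullet> x = b}"
    using ab(3) by (intro hull_minimal affine_hyperplane) auto
  moreover have "F \<noteq> {}" "convex F" "aff_dim F = aff_dim K - 1"
    using F by (auto simp: facet_of_def face_of_imp_convex)
  ultimately have hull: "affine hull F = {x. a \<bullet> x = b}"
    using ab(1) by (intro affine_dim_equal) (auto simp: affine_hyperplane dim aff_dim_hyperplane)
  obtain p where "p \<in> rel_interior F"
    using rel_interior_eq_empty[OF \<open>convex F\<close>] \<open>F \<noteq> {}\<close> by auto
  then obtain r where r: "p \<in> F" "r > 0" "cball p r \<inter> affine hull F \<subseteq> F"
    unfolding mem_rel_interior_cball by auto
  show ?thesis
  proof
    show "norm (sgn a) = 1" "r > 0" using ab(1) r(2) by (simp_all add: norm_sgn)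
    show "sgn a \<bullet> x \<le> sgn a \<bullet> p" if "x \<in> K" for x
    proof -
      have "a \<bullet> x \<le> a \<bullet> p" using that ab r(1) by auto
      then show ?thesis by (simp add: sgn_div_norm mult_left_mono)
    qed
    show "p + w \<in> K" if "sgn a \<bullet> w = 0" "norm w \<le> r" for w
    proof -
      have "a \<bullet> w = 0" using that(1) ab(1) by (simp add: sgn_div_norm)
      then have "p + w \<in> cball p r \<inter> affine hull F"
        using that(2) r(1) ab(3) unfolding hull by (auto simp: dist_norm inner_add_right)
      then show ?thesis using r(3) ab(3) by auto
    qed
  qed
qed

text \<open>
  The cylinder of radius \<open>r\<close> and height \<open>s\<close> standing on \<open>p\<close> in direction \<open>u\<close> excludes its base, so that
  it is disjoint from a body supported by the base hyperplane.
\<close>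
definition cylinder :: "'a::euclidean_space \<Rightarrow> 'a \<Rightarrow> real \<Rightarrow> real \<Rightarrow> 'a set" where
  "cylinder p u r s =
     {x. 0 < u \<bullet> (x - p) \<and> u \<bullet> (x - p) \<le> s \<and> norm ((x - p) - (u \<bullet> (x - p)) *\<^sub>R u) \<le> r}"

lemma lmeasurable_cylinder:
  assumes "norm u = 1"
  shows "cylinder p u r s \<in> lmeasurable"
proof (rule bounded_set_imp_lmeasurable)
  have "norm (x - p) \<le> s + r" if "x \<in> cylinder p u r s" for x
    using that norm_triangle_ineq[of "(x - p) - (u \<bullet> (x - p)) *\<^sub>R u" "(u \<bullet> (x - p)) *\<^sub>R u"] assms
    by (simp add: cylinder_def)
  then show "bounded (cylinder p u r s)"
    by (intro bounded_subset[OF bounded_cball[of p "s + r"]]) (auto simp: dist_norm norm_minus_commute)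
  have "cylinder p u r s \<in> sets borel"
    unfolding cylinder_def by measurable
  then show "cylinder p u r s \<in> sets lebesgue" by simp
qed

lemma measure_cylinder_pos:
  assumes "norm u = 1" "r > 0"
  shows "0 < measure lebesgue (cylinder p u r 1)"
proof -
  define e where "e = min (1 / 2) (r / 2)"
  have "e > 0" using assms by (simp add: e_def)
  have "ball (p + (1 / 2) *\<^sub>R u) e \<subseteq> cylinder p u r 1"
  proof
    fix x assume "x \<in> ball (p + (1 / 2) *\<^sub>R u) e"
    define v where "v = x - p - (1 / 2) *\<^sub>R u"
    have v: "norm v < e" "x - p = (1 / 2) *\<^sub>R u + v"
      using \<open>x \<in> _\<close> by (auto simp: v_def dist_norm norm_minus_commute algebra_simps)
    have uu: "u \<bullet> u = 1" using assms(1) by (simp add: dot_square_norm)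
    have uv: "\<bar>u \<bullet> v\<bar> \<le> norm v" using Cauchy_Schwarz_ineq2[of u v] assms(1) by simp
    have "(x - p) - (u \<bullet> (x - p)) *\<^sub>R u = v - (u \<bullet> v) *\<^sub>R u"
      by (simp add: v(2) inner_add_right uu algebra_simps)
    also have "norm \<dots> \<le> norm v + norm v"
      using norm_triangle_ineq4[of v "(u \<bullet> v) *\<^sub>R u"] uv assms(1) by simp
    finally have "norm ((x - p) - (u \<bullet> (x - p)) *\<^sub>R u) \<le> r"
      using v(1) by (simp add: e_def)
    moreover have "u \<bullet> (x - p) = 1 / 2 + u \<bullet> v" by (simp add: v(2) inner_add_right uu)
    moreover have "\<bar>u \<bullet> v\<bar> < 1 / 2" using uv v(1) by (simp add: e_def)
    ultimately show "x \<in> cylinder p u r 1"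
      unfolding cylinder_def mem_Collect_eq by linarith
  qed
  then have "measure lebesgue (ball (p + (1 / 2) *\<^sub>R u) e) \<le> measure lebesgue (cylinder p u r 1)"
    using assms(1) by (intro measure_mono_fmeasurable lmeasurable_cylinder) auto
  moreover have "0 < measure lebesgue (ball (p + (1 / 2) *\<^sub>R u) e)"
    using content_ball_pos[OF \<open>e > 0\<close>] by simp
  ultimately show ?thesis by linarith
qed

text \<open>
  The linear growth of the volume in the height: \<open>N\<close> translates of a slice of height \<open>1 / N\<close> cover the
  cylinder of height 1.
\<close>
lemma measure_cylinder_slice:
  assumes "norm u = 1" "N > 0"
  shows "measure lebesgue (cylinder p u r 1) / real N \<le> measure lebesgue (cylinder p u r (1 / real N))"
proof -
  let ?C = "cylinder p u r (1 / real N)"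
  have uu: "u \<bullet> u = 1" using assms(1) by (simp add: dot_square_norm)
  have meas: "(+) ((real k / real N) *\<^sub>R u) ` ?C \<in> lmeasurable" for k
    using assms(1) by (intro measurable_translation lmeasurable_cylinder)
  have "cylinder p u r 1 \<subseteq> (\<Union>k<N. (+) ((real k / real N) *\<^sub>R u) ` ?C)"
  proof
    fix x assume x: "x \<in> cylinder p u r 1"
    define a where "a = u \<bullet> (x - p)"
    \<comment> \<open>The slices are open at the bottom and closed at the top, hence the ceiling minus one.\<close>
    define k where "k = nat (\<lceil>a * real N\<rceil> - 1)"
    have a: "0 < a" "a \<le> 1" using x by (auto simp: cylinder_def a_def)
    then have "0 < a * real N" "a * real N \<le> real N" using assms(2) by (auto simp: mult_le_cancel_right2)
    then have k: "real k < a * real N" "a * real N \<le> real k + 1" "k < N"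
      unfolding k_def by linarith+
    define y where "y = x - (real k / real N) *\<^sub>R u"
    have uy: "u \<bullet> (y - p) = a - real k / real N"
      by (simp add: y_def a_def inner_diff_right uu)
    have "(y - p) - (u \<bullet> (y - p)) *\<^sub>R u = (x - p) - a *\<^sub>R u"
      unfolding uy by (simp add: y_def algebra_simps)
    then have "norm ((y - p) - (u \<bullet> (y - p)) *\<^sub>R u) \<le> r"
      using x unfolding cylinder_def a_def by (simp only: mem_Collect_eq)
    moreover have "0 < u \<bullet> (y - p)" "u \<bullet> (y - p) \<le> 1 / real N"
    proof -
      have "real k / real N < a" "a \<le> (real k + 1) / real N"
        using k assms(2) by (simp_all add: pos_divide_less_eq pos_le_divide_eq)
      then show "0 < u \<bullet> (y - p)" "u \<bullet> (y - p) \<le> 1 / real N"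
        by (simp_all add: uy add_divide_distrib)
    qed
    ultimately have "y \<in> ?C" by (simp add: cylinder_def)
    then have "x \<in> (+) ((real k / real N) *\<^sub>R u) ` ?C"
      by (intro image_eqI[of _ _ y]) (simp add: y_def)
    with k(3) show "x \<in> (\<Union>k<N. (+) ((real k / real N) *\<^sub>R u) ` ?C)" by blast
  qed
  then have "measure lebesgue (cylinder p u r 1) \<le> measure lebesgue (\<Union>k<N. (+) ((real k / real N) *\<^sub>R u) ` ?C)"
    using assms(1) meas
    by (intro measure_mono_fmeasurable fmeasurable.finite_UN fmeasurableD[OF lmeasurable_cylinder]) auto
  also have "\<dots> \<le> (\<Sum>k<N. measure lebesgue ((+) ((real k / real N) *\<^sub>R u) ` ?C))"
    using meas by (intro measure_UNION_le) (auto intro: fmeasurableD)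
  also have "\<dots> = real N * measure lebesgue ?C"
    by (simp add: measure_translation)
  finally show ?thesis using assms(2) by (simp add: field_simps)
qed

text \<open>
  At height at most \<open>t / 2\<close> the cone with apex \<open>p + t u\<close> over a disc of radius \<open>r\<close> still has radius at
  least \<open>r / 2\<close>.
\<close>
lemma cylinder_subset_apex_hull:
  assumes "norm u = 1" "t > 0"
    and disc: "\<And>w. u \<bullet> w = 0 \<Longrightarrow> norm w \<le> r \<Longrightarrow> p + w \<in> K"
  shows "cylinder p u (r / 2) (t / 2) \<subseteq> convex hull (insert (p + t *\<^sub>R u) K)"
proof
  fix x assume x: "x \<in> cylinder p u (r / 2) (t / 2)"
  define a where "a = u \<bullet> (x - p)"
  define w where "w = (x - p) - a *\<^sub>R u"
  define c where "c = a / t"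
  have uu: "u \<bullet> u = 1" using assms(1) by (simp add: dot_square_norm)
  have a: "0 < a" "a \<le> t / 2" "norm w \<le> r / 2"
    using x by (auto simp: cylinder_def a_def w_def)
  then have c: "0 < c" "c \<le> 1 / 2" using assms(2) by (auto simp: c_def field_simps)
  have "u \<bullet> w = 0" by (simp add: w_def a_def inner_diff_right uu)
  moreover have "norm ((1 / (1 - c)) *\<^sub>R w) \<le> 2 * norm w"
    using c mult_right_mono[of "1 / (1 - c)" 2 "norm w"] by (simp add: field_simps)
  ultimately have "p + (1 / (1 - c)) *\<^sub>R w \<in> K"
    using a(3) by (intro disc) auto
  then have "c *\<^sub>R (p + t *\<^sub>R u) + (1 - c) *\<^sub>R (p + (1 / (1 - c)) *\<^sub>R w) \<in> convex hull (insert (p + t *\<^sub>R u) K)"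
    using c by (intro convexD[OF convex_convex_hull]) (auto simp: hull_inc)
  also have "c *\<^sub>R (p + t *\<^sub>R u) + (1 - c) *\<^sub>R (p + (1 / (1 - c)) *\<^sub>R w) = p + (c * t) *\<^sub>R u + w"
    using c by (simp add: algebra_simps)
  also have "\<dots> = x" using assms(2) by (simp add: c_def w_def)
  finally show "x \<in> convex hull (insert (p + t *\<^sub>R u) K)" .
qed

lemma apex_volume_gain:
  fixes K :: "'a::euclidean_space set"
  assumes "norm u = 1" "r > 0" "compact K" "N > 0"
    and supp: "\<And>x. x \<in> K \<Longrightarrow> u \<bullet> x \<le> u \<bullet> p"
    and disc: "\<And>w. u \<bullet> w = 0 \<Longrightarrow> norm w \<le> r \<Longrightarrow> p + w \<in> K"
  shows "measure lebesgue K + measure lebesgue (cylinder p u (r / 2) 1) / real N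
           \<le> measure lebesgue (convex hull (insert (p + (2 / real N) *\<^sub>R u) K))" (is "_ \<le> measure lebesgue ?L")
proof -
  let ?C = "cylinder p u (r / 2) (1 / real N)"
  have C: "?C \<in> lmeasurable" using assms(1) by (rule lmeasurable_cylinder)
  have K: "K \<in> lmeasurable" using assms(3) by (rule lmeasurable_compact)
  have "?C - K = ?C" using supp by (force simp: cylinder_def inner_diff_right)
  then have "measure lebesgue (K \<union> ?C) = measure lebesgue K + measure lebesgue ?C"
    using measure_Un2[OF K C] by simp
  moreover have "measure lebesgue (K \<union> ?C) \<le> measure lebesgue ?L"
  proof (rule measure_mono_fmeasurable)
    have "?C \<subseteq> ?L"
      using cylinder_subset_apex_hull[of u "2 / real N" r p K] assms by simp
    then show "K \<union> ?C \<subseteq> ?L" by (auto simp: hull_inc)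
    show "?L \<in> lmeasurable"
      using assms(3) by (intro lmeasurable_compact compact_convex_hull) simp
    show "K \<union> ?C \<in> sets lebesgue" using C K by (intro sets.Un fmeasurableD)
  qed
  ultimately show ?thesis
    using measure_cylinder_slice[OF assms(1,4), of p "r / 2"] by linarith
qed

section \<open>Adding an apex over a facet: loss of the polar volume\<close>

lemma measure_cball_scale:
  fixes c :: "'a::euclidean_space"
  assumes "R \<ge> 0"
  shows "measure lebesgue (cball c R) = R ^ DIM('a) * measure lebesgue (ball (0::'a) 1)"
  using content_ball_conv_unit_ball[OF assms, of c] by (simp add: content_cball_conv_ball)

text \<open>
  Let \<open>w = y - z\<close> with \<open>y\<close> in the part cut off, and split \<open>w = v + \<alpha> u\<close> with \<open>v\<close> orthogonal to \<open>u\<close>. As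
  \<open>w\<close> exceeds 1 at the apex, it is at least \<open>1 - O(t)\<close> at \<open>p\<close>; as it is at most 1 on the disc about \<open>p\<close>,
  its component \<open>v\<close> along the disc is \<open>O(t)\<close>. Evaluating at \<open>p\<close> again shows \<open>\<alpha> = 1 / h + O(t)\<close>, where
  \<open>h\<close> is the distance from \<open>z\<close> to the facet hyperplane. So \<open>y\<close> is within \<open>O(t)\<close> of \<open>z + u / h\<close>, the
  vertex of the polar dual to the facet. The constant depends on \<open>z\<close> only through \<open>\<rho>\<close> and \<open>D\<close>.
\<close>
lemma apex_polar_loss:
  fixes K :: "'a::euclidean_space set"
  assumes u: "norm u = 1" and "r > 0" "\<rho> > 0" "t > 0"
    and ball: "cball z \<rho> \<subseteq> K" and D: "dist z p \<le> D"
    and supp: "\<And>x. x \<in> K \<Longrightarrow> u \<bullet> x \<le> u \<bullet> p"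
    and disc: "\<And>w. u \<bullet> w = 0 \<Longrightarrow> norm w \<le> r \<Longrightarrow> p + w \<in> K"
  defines "C \<equiv> 1 / (r * \<rho>) + (1 + D / r) / \<rho>\<^sup>2"
  shows "measure lebesgue (polar_body K z) \<le>
           measure lebesgue (polar_body (convex hull (insert (p + t *\<^sub>R u) K)) z)
             + (C * t) ^ DIM('a) * measure lebesgue (ball (0::'a) 1)"
proof -
  let ?L = "convex hull (insert (p + t *\<^sub>R u) K)"
  have z: "z \<in> interior K" "z \<in> K" 
    using ball \<open>\<rho> > 0\<close> mem_interior_cball[of z K] by auto
  have uu: "u \<bullet> u = 1" using u by (simp add: dot_square_norm)
  define h where "h = u \<bullet> (p - z)"
  have "h \<ge> \<rho>"
  proof -
    have "z + \<rho> *\<^sub>R u \<in> K" using ball u \<open>\<rho> > 0\<close> by (auto simp: dist_norm subset_iff)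
    from supp[OF this] show ?thesis by (simp add: h_def inner_add_right inner_diff_right uu)
  qed
  have "D \<ge> 0" using D zero_le_dist[of z p] by linarith
  have "polar_body K z \<subseteq> polar_body ?L z \<union> cball (z + (1 / h) *\<^sub>R u) (C * t)"
  proof
    fix y assume y: "y \<in> polar_body K z"
    define w where "w = y - z"
    define \<alpha> where "\<alpha> = u \<bullet> w"
    define v where "v = w - \<alpha> *\<^sub>R u"
    have le1: "w \<bullet> (x - z) \<le> 1" if "x \<in> K" for x
      using y that by (simp add: polar_body_def w_def)
    show "y \<in> polar_body ?L z \<union> cball (z + (1 / h) *\<^sub>R u) (C * t)"
    proof (cases "w \<bullet> (p + t *\<^sub>R u - z) \<le> 1")
      case True
      then have "y \<in> polar_body ?L z"
        using le1 unfolding polar_body_convex_hull by (simp add: polar_body_def w_def)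
      then show ?thesis by blast
    next
      case False
      then have big: "w \<bullet> (p - z) > 1 - t * \<alpha>"
        by (simp add: \<alpha>_def inner_add_right inner_diff_right inner_commute)
      have "\<rho> * norm w \<le> 1" using ball \<open>\<rho> > 0\<close> le1 by (intro norm_le_of_inner_le_on_cball[of z \<rho> K]) auto
      then have "norm w \<le> 1 / \<rho>" using \<open>\<rho> > 0\<close> by (simp add: field_simps)
      moreover have "\<bar>\<alpha>\<bar> \<le> norm w" using Cauchy_Schwarz_ineq2[of u w] u by (simp add: \<alpha>_def)
      ultimately have \<alpha>: "\<bar>\<alpha>\<bar> \<le> 1 / \<rho>" by linarith
      then have t\<alpha>: "t * \<alpha> \<le> t / \<rho>"
        using mult_left_mono[of \<alpha> "1 / \<rho>" t] \<open>t > 0\<close> by simp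
      have uv: "u \<bullet> v = 0" by (simp add: v_def \<alpha>_def inner_diff_right uu)
      have wv: "w \<bullet> v = norm v ^ 2"
      proof -
        have "w = v + \<alpha> *\<^sub>R u" by (simp add: v_def)
        then show ?thesis using uv by (simp add: inner_add_left dot_square_norm)
      qed
      have v: "r * norm v \<le> t / \<rho>"
      proof (cases "v = 0")
        case False
        have "p + (r / norm v) *\<^sub>R v \<in> K"
          using uv \<open>r > 0\<close> False by (intro disc) auto
        from le1[OF this] have "w \<bullet> (p - z) + (r / norm v) * (w \<bullet> v) \<le> 1"
          by (simp add: inner_add_right inner_diff_right)
        then have "w \<bullet> (p - z) + r * norm v \<le> 1"
          using False by (simp add: wv power2_eq_square)
        with big t\<alpha> show ?thesis by linarith
      qed (use \<open>t > 0\<close> \<open>\<rho> > 0\<close> in auto)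
      then have v': "norm v \<le> t / (r * \<rho>)"
        using \<open>r > 0\<close> \<open>\<rho> > 0\<close> by (simp add: field_simps)
      have \<alpha>h: "\<alpha> * h = w \<bullet> (p - z) - v \<bullet> (p - z)"
        by (simp add: v_def h_def inner_diff_left)
      have "\<bar>v \<bullet> (p - z)\<bar> \<le> norm v * norm (p - z)" by (rule Cauchy_Schwarz_ineq2)
      also have "\<dots> \<le> t / (r * \<rho>) * D"
        using v' D \<open>t > 0\<close> \<open>r > 0\<close> \<open>\<rho> > 0\<close> by (intro mult_mono) (simp_all add: dist_norm norm_minus_commute)
      finally have vp: "\<bar>v \<bullet> (p - z)\<bar> \<le> t / (r * \<rho>) * D" .
      have "p \<in> K" using disc[of 0] \<open>r > 0\<close> by simp
      with le1[of p] big t\<alpha> vp have "\<bar>\<alpha> * h - 1\<bar> \<le> t / \<rho> + t / (r * \<rho>) * D"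
        using \<open>t > 0\<close> \<open>\<rho> > 0\<close> unfolding \<alpha>h by (simp add: abs_le_iff)
      also have "\<dots> = t / \<rho> * (1 + D / r)" using \<open>\<rho> > 0\<close> \<open>r > 0\<close> by (simp add: field_simps)
      finally have "\<bar>\<alpha> * h - 1\<bar> / h \<le> t / \<rho> * (1 + D / r) / \<rho>"
        using \<open>h \<ge> \<rho>\<close> \<open>\<rho> > 0\<close> \<open>t > 0\<close> \<open>r > 0\<close> \<open>D \<ge> 0\<close> by (intro frac_le) auto
      moreover have "\<bar>\<alpha> * h - 1\<bar> / h = \<bar>\<alpha> - 1 / h\<bar>"
      proof -
        have "\<alpha> - 1 / h = (\<alpha> * h - 1) / h"
          using \<open>h \<ge> \<rho>\<close> \<open>\<rho> > 0\<close> by (simp add: diff_divide_distrib)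
        then show ?thesis using \<open>h \<ge> \<rho>\<close> \<open>\<rho> > 0\<close> by simp
      qed
      ultimately have \<alpha>': "\<bar>\<alpha> - 1 / h\<bar> \<le> t / \<rho> * (1 + D / r) / \<rho>" by simp
      have "y - (z + (1 / h) *\<^sub>R u) = v + (\<alpha> - 1 / h) *\<^sub>R u"
        by (simp add: v_def w_def algebra_simps)
      then have "norm (y - (z + (1 / h) *\<^sub>R u)) \<le> norm v + \<bar>\<alpha> - 1 / h\<bar>"
        using norm_triangle_ineq[of v "(\<alpha> - 1 / h) *\<^sub>R u"] u by simp
      also have "\<dots> \<le> t / (r * \<rho>) + t / \<rho> * (1 + D / r) / \<rho>" using v' \<alpha>' by linarith
      also have "\<dots> = C * t"
        by (simp add: C_def power2_eq_square algebra_simps add_divide_distrib)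
      finally show ?thesis by (simp add: dist_norm norm_minus_commute)
    qed
  qed
  moreover have "C * t \<ge> 0"
    using \<open>r > 0\<close> \<open>\<rho> > 0\<close> \<open>t > 0\<close> \<open>D \<ge> 0\<close> by (simp add: C_def)
  moreover have "z \<in> interior ?L"
    using z(1) interior_mono[of K ?L] by (auto simp: hull_inc subset_iff)
  ultimately have "measure lebesgue (polar_body K z) \<le>
      measure lebesgue (polar_body ?L z \<union> cball (z + (1 / h) *\<^sub>R u) (C * t))"
    using closed_polar_body[of K z]
    by (intro measure_mono_fmeasurable fmeasurable.Un lmeasurable_polar_body) auto
  also have "\<dots> \<le> measure lebesgue (polar_body ?L z) + measure lebesgue (cball (z + (1 / h) *\<^sub>R u) (C * t))"
    using closed_polar_body[of ?L z] by (intro measure_Un_le) auto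
  finally show ?thesis using \<open>C * t \<ge> 0\<close> by (simp only: measure_cball_scale)
qed

section \<open>Centers close to the boundary\<close>

text \<open>
  If \<open>L\<close> hardly extends beyond \<open>z\<close> in direction \<open>v\<close>, its polar contains a long segment from \<open>z\<close> in
  that direction and also a ball of radius \<open>1 / D\<close>; along the first half of the segment there is room
  for \<open>N\<close> disjoint balls of radius \<open>1 / (2 * D)\<close>.
\<close>
lemma polar_volume_blowup:
  fixes L :: "'a::euclidean_space set"
  assumes z: "z \<in> interior L" and L: "L \<subseteq> cball z D" and "D > 0" "norm v = 1" "\<eta> > 0"
    and supp: "\<And>x. x \<in> L \<Longrightarrow> v \<bullet> (x - z) \<le> \<eta>" and N: "2 * real N * \<eta> \<le> D"
  shows "real N * measure lebesgue (ball (0::'a) (1 / (2 * D))) \<le> measure lebesgue (polar_body L z)"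
proof -
  define c where "c k = z + (real k / D) *\<^sub>R v" for k :: nat
  let ?B = "\<lambda>k. ball (c k) (1 / (2 * D))"
  have vol: "measure lebesgue (?B k) = measure lebesgue (ball (0::'a) (1 / (2 * D)))" for k
    using content_ball_conv_unit_ball[of "1 / (2 * D)" "c k"] content_ball_conv_unit_ball[of "1 / (2 * D)" "0::'a"] \<open>D > 0\<close>
    by simp
  have disj: "?B k \<inter> ?B l = {}" if "k \<noteq> l" for k l
  proof (rule disjoint_ballI)
    have "c k - c l = ((real k - real l) / D) *\<^sub>R v"
      by (simp add: c_def algebra_simps diff_divide_distrib)
    then have "dist (c k) (c l) = \<bar>real k - real l\<bar> / D"
      using \<open>norm v = 1\<close> \<open>D > 0\<close> by (simp add: dist_norm)
    moreover have "1 \<le> \<bar>real k - real l\<bar>" using that by linarith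
    ultimately show "1 / (2 * D) + 1 / (2 * D) \<le> dist (c k) (c l)"
      using \<open>D > 0\<close> by (simp add: field_simps)
  qed
  have "?B k \<subseteq> polar_body L z" if "k < N" for k
  proof
    fix y assume y: "y \<in> ?B k"
    have "(y - z) \<bullet> (x - z) \<le> 1" if "x \<in> L" for x
    proof -
      have "(y - c k) \<bullet> (x - z) \<le> norm (y - c k) * norm (x - z)" by (rule norm_cauchy_schwarz)
      also have "\<dots> \<le> 1 / (2 * D) * D"
        using y that L \<open>D > 0\<close> by (intro mult_mono) (auto simp: dist_norm norm_minus_commute subset_iff)
      finally have 1: "(y - c k) \<bullet> (x - z) \<le> 1 / 2" using \<open>D > 0\<close> by simp
      have "real k / D * (v \<bullet> (x - z)) \<le> real N / D * \<eta>"
        using supp[OF that] \<open>k < N\<close> \<open>D > 0\<close> \<open>\<eta> > 0\<close>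
        by (intro order_trans[OF mult_left_mono mult_right_mono[where c = \<eta>]] divide_right_mono) auto
      also have "\<dots> \<le> 1 / 2" using N \<open>D > 0\<close> by (simp add: field_simps)
      finally have "(c k - z) \<bullet> (x - z) \<le> 1 / 2" by (simp add: c_def)
      moreover have "(y - z) \<bullet> (x - z) = (y - c k) \<bullet> (x - z) + (c k - z) \<bullet> (x - z)"
        by (simp flip: inner_add_left)
      ultimately show ?thesis using 1 by linarith
    qed
    then show "y \<in> polar_body L z" by (simp add: polar_body_def)
  qed
  then have "measure lebesgue (\<Union>k<N. ?B k) \<le> measure lebesgue (polar_body L z)"
    using z by (intro measure_mono_fmeasurable lmeasurable_polar_body) auto
  also have "measure lebesgue (\<Union>k<N. ?B k) = (\<Sum>k<N. measure lebesgue (?B k))"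
    using disj by (intro measure_negligible_finite_Union_image) (auto simp: pairwise_def)
  finally show ?thesis unfolding vol by simp
qed

lemma cone_hull_near:
  fixes K :: "'a::euclidean_space set"
  assumes "convex K" "p \<in> K" "norm u = 1" "t \<ge> 0" "x \<in> convex hull (insert (p + t *\<^sub>R u) K)"
  obtains y where "y \<in> K" "dist x y \<le> t"
proof -
  let ?I = "insert (p + t *\<^sub>R u) K" and ?f = "\<lambda>q. if q \<in> K then q else p"
  have "dist q (?f q) \<le> t" if "q \<in> ?I" for q
    using that assms(3,4) by (auto simp: dist_norm)
  then obtain y where "y \<in> convex hull (?f ` ?I)" "dist x y \<le> t"
    using convex_hull_near[of ?I "\<lambda>q. q" ?f t x] assms(5) by auto
  moreover have "convex hull (?f ` ?I) \<subseteq> K"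
    using assms(1,2) by (intro hull_minimal) auto
  ultimately show ?thesis using that by blast
qed

section \<open>Strict increase\<close>

text \<open>
  The constants are fixed in this order: \<open>n\<close> is so large that \<open>n\<close> balls of volume \<open>\<kappa>\<close> in the polar
  already force a product of at least \<open>P + 1\<close>, which settles every center within \<open>\<rho>\<close> of the complement
  of \<open>K\<close>. This \<open>\<rho>\<close> determines the constant \<open>E\<close> of the quadratic loss, and \<open>t\<close> is then taken so small
  that for the remaining centers the loss eats up at most half of the gain \<open>g * t * v0\<close>. The same
  \<open>t\<close> serves all centers, which makes the infimum itself strictly larger.
\<close>
theorem apex_increases_volume_product:
  fixes K :: "'a::euclidean_space set"
  assumes dim: "DIM('a) \<ge> 2" and K: "polytope K" "interior K \<noteq> {}"
  obtains q where "volume_product K < volume_product (convex hull (insert q K))"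
proof -
  obtain p u r where u: "norm u = 1" and r: "r > 0"
    and supp: "\<And>x. x \<in> K \<Longrightarrow> u \<bullet> x \<le> u \<bullet> p"
    and disc: "\<And>w. u \<bullet> w = 0 \<Longrightarrow> norm w \<le> r \<Longrightarrow> p + w \<in> K"
    using facet_disc[OF K] by metis
  have "p \<in> K" using disc[of 0] r by simp
  have "compact K" "convex K" using K(1) by (auto simp: polytope_imp_compact polytope_imp_convex)
  define \<mu> where "\<mu> = measure (lebesgue :: 'a measure)"
  define P where "P = volume_product K"
  define V where "V = \<mu> K"
  have "V > 0"
  proof -
    obtain z e where "e > 0" "ball z e \<subseteq> K" using K(2) unfolding interior_def open_contains_ball by blast
    then have "\<mu> (ball z e) \<le> V" 
      unfolding \<mu>_def V_def using \<open>compact K\<close> by (intro measure_mono_fmeasurable lmeasurable_compact) auto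
    moreover have "0 < \<mu> (ball z e)"
      using content_ball_pos[OF \<open>e > 0\<close>] by (simp add: \<mu>_def)
    ultimately show ?thesis by linarith
  qed
  obtain D0 where D0: "D0 > 0" "\<And>x y. x \<in> K \<Longrightarrow> y \<in> K \<Longrightarrow> dist x y \<le> D0"
  proof -
    have "bounded K" using \<open>compact K\<close> by (rule compact_imp_bounded)
    then obtain e where "\<And>y. y \<in> K \<Longrightarrow> dist p y \<le> e" by (meson bounded_any_center)
    then have "dist x y \<le> 2 * \<bar>e\<bar> + 1" if "x \<in> K" "y \<in> K" for x y
      using that dist_triangle2[of x y p] by (smt (verit) dist_commute)
    then show ?thesis by (intro that[of "2 * \<bar>e\<bar> + 1"]) auto
  qed
  \<comment> \<open>A bound for the diameter of the enlarged body, whose points are within \<open>t \<le> 1\<close> of \<open>K\<close>.\<close>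
  define D where "D = D0 + 2"
  have "D > 0" using D0(1) by (simp add: D_def)
  \<comment> \<open>A lower bound for the volume of the polar of \<open>K\<close> at any point of its interior.\<close>
  define v0 where "v0 = \<mu> (cball (0::'a) (1 / D))"
  define \<kappa> where "\<kappa> = \<mu> (ball (0::'a) (1 / (2 * D)))"
  have pos: "v0 > 0" "\<kappa> > 0"
    using content_cball_pos[of "1 / D" "0::'a"] content_ball_pos[of "1 / (2 * D)" "0::'a"] \<open>D > 0\<close>
    by (simp_all add: v0_def \<kappa>_def \<mu>_def)
  obtain n where n: "real n > (P + 1) / (V * \<kappa>)" "n > 0"
    using reals_Archimedean2[of "max 0 ((P + 1) / (V * \<kappa>))"] by auto
  define \<rho> where "\<rho> = D / (4 * real n)"
  have "\<rho> > 0" using \<open>D > 0\<close> n by (simp add: \<rho>_def)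
  define C where "C = 1 / (r * \<rho>) + (1 + D / r) / \<rho>\<^sup>2"
  define E where "E = C ^ DIM('a) * \<mu> (ball (0::'a) 1)"
  have "C \<ge> 0" "E \<ge> 0" using \<open>\<rho> > 0\<close> r \<open>D > 0\<close> by (simp_all add: C_def E_def \<mu>_def)
  define g where "g = \<mu> (cylinder p u (r / 2) 1) / 2"
  have "g > 0" using measure_cylinder_pos[OF u, of "r / 2" p] r by (simp add: g_def \<mu>_def)
  define \<tau> where "\<tau> = min (min 1 \<rho>) (g * v0 / (2 * (E * (V + g) + 1)))"
  have "E * (V + g) \<ge> 0" using \<open>E \<ge> 0\<close> \<open>V > 0\<close> \<open>g > 0\<close> by simp
  then have "\<tau> > 0" using \<open>\<rho> > 0\<close> \<open>g > 0\<close> pos by (simp add: \<tau>_def)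
  obtain N where N: "real N > 2 / \<tau>" using reals_Archimedean2 by blast
  then have "real N > 0" using \<open>\<tau> > 0\<close> by (smt (verit) divide_pos_pos)
  define t where "t = 2 / real N"
  have t: "t > 0" "t \<le> \<tau>"
    using N \<open>real N > 0\<close> \<open>\<tau> > 0\<close> by (auto simp: t_def field_simps)
  then have t1: "t \<le> 1" "t \<le> \<rho>" by (auto simp: \<tau>_def)
  have tE: "t * (E * (V + g)) \<le> g * v0 / 2"
  proof -
    have "t * (E * (V + g)) \<le> t * (E * (V + g) + 1)" using t by (simp add: algebra_simps)
    also have "\<dots> \<le> g * v0 / (2 * (E * (V + g) + 1)) * (E * (V + g) + 1)"
      using t(2) \<open>E * (V + g) \<ge> 0\<close> by (intro mult_right_mono) (auto simp: \<tau>_def)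
    also have "\<dots> = g * v0 / 2" using \<open>E * (V + g) \<ge> 0\<close> by (simp add: field_simps)
    finally show ?thesis .
  qed
  let ?L = "convex hull (insert (p + t *\<^sub>R u) K)"
  have sub: "K \<subseteq> ?L" by (simp add: hull_subset subset_insertI hull_inc subsetI)
  have gain: "V + g * t \<le> \<mu> ?L"
    using apex_volume_gain[OF u r \<open>compact K\<close> _ supp disc, of N] \<open>real N > 0\<close>
    by (simp add: V_def g_def t_def \<mu>_def)
  have near: "\<exists>y\<in>K. dist x y \<le> t" if "x \<in> ?L" for x
    using cone_hull_near[OF \<open>convex K\<close> \<open>p \<in> K\<close> u, of t x] t that by auto
  have diam: "?L \<subseteq> cball z D" if z: "z \<in> ?L" for z
  proof
    fix x assume "x \<in> ?L"
    then obtain x' z' where xz: "x' \<in> K" "dist x x' \<le> t" "z' \<in> K" "dist z z' \<le> t"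
      using near z by metis
    then show "x \<in> cball z D"
      using D0(2)[OF xz(1,3)] t1 dist_triangle[of z x z'] dist_triangle[of z' x x']
      by (simp add: D_def dist_commute)
  qed
  let ?c = "min (P + 1) (P + t * (g * v0 / 2))"
  have "interior ?L \<noteq> {}" using K(2) interior_mono[OF sub] by auto
  then have "?c \<le> volume_product ?L"
  proof (rule le_volume_product)
    show "?c \<le> measure lebesgue ?L * measure lebesgue (polar_body ?L z)" if z: "z \<in> interior ?L" for z
    proof (cases "cball z \<rho> \<subseteq> K")
      case True
      have "z \<in> K" "z \<in> interior K"
        using True \<open>\<rho> > 0\<close> mem_interior_cball[of z K] by auto
      have "P \<le> V * \<mu> (polar_body K z)"
        unfolding P_def V_def \<mu>_def by (rule volume_product_le) fact
      have "v0 \<le> \<mu> (polar_body K z)"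
      proof -
        have "v0 = \<mu> (cball z (1 / D))"
        proof -
          have "0 \<le> 1 / D" using \<open>D > 0\<close> by simp
          then show ?thesis unfolding v0_def \<mu>_def by (simp only: measure_cball_scale)
        qed
        also have "\<dots> \<le> \<mu> (polar_body K z)"
          unfolding \<mu>_def using diam[of z] sub \<open>z \<in> K\<close> \<open>D > 0\<close> \<open>z \<in> interior K\<close>
          by (intro measure_mono_fmeasurable cball_subset_polar_body lmeasurable_polar_body) auto
        finally show ?thesis .
      qed
      have "dist z p \<le> D" using D0(2)[OF \<open>z \<in> K\<close> \<open>p \<in> K\<close>] by (simp add: D_def)
      have "\<mu> (polar_body K z) \<le> \<mu> (polar_body ?L z) + (C * t) ^ DIM('a) * \<mu> (ball (0::'a) 1)"
        unfolding \<mu>_def C_def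
        by (rule apex_polar_loss[OF u r \<open>\<rho> > 0\<close> t(1) True \<open>dist z p \<le> D\<close> supp disc])
      moreover have "(C * t) ^ DIM('a) * \<mu> (ball (0::'a) 1) \<le> E * t\<^sup>2"
      proof -
        have "t ^ DIM('a) \<le> t\<^sup>2" using dim t t1 by (intro power_decreasing) auto
        then have "E * t ^ DIM('a) \<le> E * t\<^sup>2" using \<open>E \<ge> 0\<close> by (rule mult_left_mono)
        then show ?thesis by (simp add: E_def power_mult_distrib mult_ac)
      qed
      ultimately have loss: "\<mu> (polar_body K z) - E * t\<^sup>2 \<le> \<mu> (polar_body ?L z)" by linarith
      have "P + t * (g * v0 / 2) \<le> P + g * t * v0 - t * (t * (E * (V + g)))"
        using mult_left_mono[OF tE, of t] t by (simp add: algebra_simps)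
      also have "\<dots> \<le> V * \<mu> (polar_body K z) + g * t * \<mu> (polar_body K z) - (V + g * t) * (E * t\<^sup>2)"
      proof -
        have "g * t * v0 \<le> g * t * \<mu> (polar_body K z)"
          using \<open>v0 \<le> _\<close> \<open>g > 0\<close> t by (intro mult_left_mono) auto
        moreover have "(V + g * t) * (E * t\<^sup>2) \<le> (V + g) * (E * t\<^sup>2)"
          using \<open>g > 0\<close> t1 \<open>E \<ge> 0\<close> t by (intro mult_right_mono) auto
        ultimately show ?thesis
          using \<open>P \<le> _\<close> by (simp add: power2_eq_square algebra_simps)
      qed
      also have "\<dots> = (V + g * t) * (\<mu> (polar_body K z) - E * t\<^sup>2)" by (simp add: algebra_simps)
      also have "\<dots> \<le> (V + g * t) * \<mu> (polar_body ?L z)"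
        using loss \<open>V > 0\<close> \<open>g > 0\<close> t by (intro mult_left_mono) auto
      also have "\<dots> \<le> \<mu> ?L * \<mu> (polar_body ?L z)"
        using gain by (intro mult_right_mono) (auto simp: \<mu>_def)
      finally show ?thesis by (simp add: \<mu>_def)
    next
      case False
      then obtain q where q: "dist z q \<le> \<rho>" "q \<notin> K"
        unfolding subset_iff mem_cball by blast
      then obtain a b where ab: "a \<bullet> q < b" "\<And>x. x \<in> K \<Longrightarrow> b < a \<bullet> x"
        using separating_hyperplane_closed_point[OF \<open>convex K\<close> compact_imp_closed[OF \<open>compact K\<close>]] by blast
      have "a \<noteq> 0" using ab(1) ab(2)[OF \<open>p \<in> K\<close>] by auto
      define v where "v = - sgn a"
      have "norm v = 1" using \<open>a \<noteq> 0\<close> by (simp add: v_def norm_sgn)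
      have cs: "v \<bullet> (x - y) \<le> dist x y" for x y
        using norm_cauchy_schwarz[of v "x - y"] \<open>norm v = 1\<close> by (simp add: dist_norm)
      have "v \<bullet> (x - z) \<le> 2 * \<rho>" if "x \<in> ?L" for x
      proof -
        obtain y where y: "y \<in> K" "dist x y \<le> t" using near[OF \<open>x \<in> ?L\<close>] by blast
        have "a \<bullet> (q - y) \<le> 0" using ab(1) ab(2)[OF y(1)] by (simp add: inner_diff_right)
        then have "v \<bullet> (y - q) \<le> 0"
          by (simp add: v_def sgn_div_norm inner_diff_right mult_left_mono)
        moreover have "v \<bullet> (x - z) = v \<bullet> (x - y) + v \<bullet> (y - q) + v \<bullet> (q - z)"
          by (simp add: inner_diff_right)
        ultimately show ?thesis
          using cs[of x y] cs[of q z] y(2) q(1) t1 by (simp add: dist_commute)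
      qed
      moreover have "2 * real n * (2 * \<rho>) \<le> D" using n by (simp add: \<rho>_def)
      moreover have "?L \<subseteq> cball z D" using diam interior_subset z by blast
      ultimately have "real n * \<kappa> \<le> \<mu> (polar_body ?L z)"
        unfolding \<kappa>_def \<mu>_def using \<open>norm v = 1\<close> \<open>\<rho> > 0\<close> \<open>D > 0\<close>
        by (intro polar_volume_blowup[OF z, where \<eta> = "2 * \<rho>"]) auto
      moreover have "V \<le> \<mu> ?L" using gain \<open>g > 0\<close> t by (smt (verit) mult_pos_pos)
      ultimately have "V * (real n * \<kappa>) \<le> \<mu> ?L * \<mu> (polar_body ?L z)"
        using \<open>V > 0\<close> pos by (intro mult_mono) (auto simp: \<mu>_def)
      moreover have "P + 1 \<le> V * (real n * \<kappa>)"
        using n(1) \<open>V > 0\<close> pos by (simp add: field_simps)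
      ultimately show ?thesis by (simp add: \<mu>_def)
    qed
  qed
  moreover have "P < ?c" using t pos \<open>g > 0\<close> by simp
  ultimately show ?thesis using that[of "p + t *\<^sub>R u"] unfolding P_def by linarith
qed

lemma exists_larger_volume_product:
  fixes K :: "'a::euclidean_space set"
  assumes "DIM('a) \<ge> 2" "K \<in> polytopes_at_most m"
  obtains L :: "'a set" where "L \<in> polytopes_at_most (Suc m)" "volume_product K < volume_product L"
proof -
  have "polytope K" "interior K \<noteq> {}" using assms(2) by (auto simp: polytopes_at_most_def)
  from apex_increases_volume_product[OF assms(1) this]
  obtain q where q: "volume_product K < volume_product (convex hull (insert q K))" .
  note V = polytope_eq_hull_vertices[OF assms(2)]
  have eq: "convex hull (insert q K) = convex hull (insert q (vertices K))"
    using V(3) hull_insert[of convex q "vertices K"] by simp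
  have "K \<subseteq> convex hull (insert q K)" by (meson hull_subset insert_subset)
  then have "interior (convex hull (insert q K)) \<noteq> {}"
    using V(4) interior_mono by blast
  moreover have "card (insert q (vertices K)) \<le> Suc m"
    using V(2) card_insert_le_m1[of "Suc m" "vertices K" q] by simp
  ultimately have "convex hull (insert q K) \<in> polytopes_at_most (Suc m)"
    unfolding eq using V(1) by (intro convex_hull_mem_polytopes_at_most) auto
  then show ?thesis using q by (rule that)
qed

section \<open>The maxima as a function of the number of vertices\<close>

lemma dimension_less_card_vertices:
  fixes K :: "'a::euclidean_space set"
  assumes "K \<in> polytopes_at_most m"
  shows "DIM('a) + 1 \<le> card (vertices K)"
proof -
  note V = polytope_eq_hull_vertices[OF assms]
  have "int (DIM('a)) = aff_dim K" using aff_dim_nonempty_interior[OF V(4)] by simp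
  also have "\<dots> = aff_dim (vertices K)" using V(3) aff_dim_convex_hull[of "vertices K"] by simp
  also have "\<dots> \<le> int (card (vertices K)) - 1" using aff_dim_le_card[OF V(1)] by simp
  finally show ?thesis by linarith
qed

lemma max_volume_product_less_Suc:
  assumes "CARD('n::finite) \<ge> 2" "CARD('n) + 1 \<le> m"
  shows "max_volume_product TYPE(real^'n) m < max_volume_product TYPE(real^'n) (Suc m)"
proof -
  obtain K :: "(real^'n) set" where K: "K \<in> polytopes_at_most m"
    "ereal (volume_product K) = max_volume_product TYPE(real^'n) m"
    using volume_product_maximizer_exists[OF assms(2)] .
  obtain L :: "(real^'n) set" where L: "L \<in> polytopes_at_most (Suc m)" "volume_product K < volume_product L"
    using exists_larger_volume_product[OF _ K(1)] assms(1) by auto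
  have "ereal (volume_product L) \<le> max_volume_product TYPE(real^'n) (Suc m)"
    unfolding max_volume_product_def using L(1) by (rule SUP_upper)
  with L(2) show ?thesis unfolding K(2)[symmetric] by (meson ereal_less_ereal_Ex less_le_trans less_ereal.simps(1))
qed

theorem theorem3p3:
  shows "(\<forall>m \<ge> CARD('n::finite) + 1.
            \<exists>K \<in> (polytopes_at_most m :: (real ^ 'n) set set).
              ereal (volume_product K) = max_volume_product TYPE(real ^ 'n) m \<and>
              (CARD('n) \<ge> 2 \<or> m = CARD('n) + 1 \<longrightarrow> card (vertices K) = m)) \<and>
         (CARD('n) \<ge> 2 \<longrightarrow>
            strict_mono_on {CARD('n) + 1..} (max_volume_product TYPE(real ^ 'n)))"
proof (intro conjI allI impI)
  fix m assume m: "CARD('n) + 1 \<le> m"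
  obtain K :: "(real^'n) set" where K: "K \<in> polytopes_at_most m"
    "ereal (volume_product K) = max_volume_product TYPE(real^'n) m"
    using volume_product_maximizer_exists[OF m] .
  have "card (vertices K) = m" if "CARD('n) \<ge> 2 \<or> m = CARD('n) + 1"
  proof (rule ccontr)
    assume "card (vertices K) \<noteq> m"
    then have less: "card (vertices K) < m"
      using K(1) by (simp add: polytopes_at_most_def)
    with dimension_less_card_vertices[OF K(1)] that
    have "CARD('n) \<ge> 2" "CARD('n) + 1 \<le> m - 1" by auto
    then have "max_volume_product TYPE(real^'n) (m - 1) < max_volume_product TYPE(real^'n) m"
      using max_volume_product_less_Suc[where 'n = 'n, of "m - 1"] by simp
    moreover have "K \<in> polytopes_at_most (m - 1)"
      using K(1) less by (auto simp: polytopes_at_most_def)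
    then have "ereal (volume_product K) \<le> max_volume_product TYPE(real^'n) (m - 1)"
      unfolding max_volume_product_def by (rule SUP_upper)
    ultimately show False using K(2) by simp
  qed
  with K show "\<exists>K \<in> (polytopes_at_most m :: (real ^ 'n) set set).
      ereal (volume_product K) = max_volume_product TYPE(real ^ 'n) m \<and>
      (CARD('n) \<ge> 2 \<or> m = CARD('n) + 1 \<longrightarrow> card (vertices K) = m)" by blast
next
  assume n: "CARD('n) \<ge> 2"
  show "strict_mono_on {CARD('n) + 1..} (max_volume_product TYPE(real ^ 'n))"
  proof (rule strict_mono_onI)
    fix k m assume "k \<in> {CARD('n) + 1..}" "m \<in> {CARD('n) + 1..}" "k < m"
    then have "max_volume_product TYPE(real^'n) k < max_volume_product TYPE(real^'n) (Suc k)"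
      using n by (intro max_volume_product_less_Suc) auto
    also have "\<dots> \<le> max_volume_product TYPE(real^'n) m"
      unfolding max_volume_product_def using \<open>k < m\<close>
      by (intro SUP_subset_mono) (auto simp: polytopes_at_most_def)
    finally show "max_volume_product TYPE(real^'n) k < max_volume_product TYPE(real^'n) m" .
  qed
qed

end
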